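(* (A generalized Ellis' theorem) Every tame compact right topological group $P$ is a topological group.
   Context: Spaces are Hausdorff. A right topological group is a group $P$ with a topology for which all right translations $x\mapsto xa$ are continuous. It is admissible if $\Lambda(P)=\{a\in P:\lambda_a:x\mapsto ax\text{ is continuous}\}$ is dense in $P$; throughout, compact right topological semigroups (in particular $P$) are assumed admissible, and this is part of the definition of tame. A map $f:X\to Y$ from a topological space to a uniform space is fragmented if for every nonempty $A\subset X$ and entourage $\varepsilon$ there is an open $O\subset X$ with $O\cap A\ne\emptyset$ and $f(O\cap A)$ $\varepsilon$-small (i.e. $f(O\cap A)\times f(O\cap A)\subset\varepsilon$). A compact admissible right topological semigroup $P$ is tame if $\lambda_a:P\to P$ is a fragmented map for every $a\in P$, where $P$ carries its unique compatible uniformity. *)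

theory Defs
  imports "HOL-Analysis.Analysis" "HOL-Algebra.Group"
begin

section \<open>Uniformities\<close>

definition uniform_structure :: "'a set \<Rightarrow> ('a \<times> 'a) set set \<Rightarrow> bool" where
  "uniform_structure X \<U> \<longleftrightarrow>
     X \<times> X \<in> \<U> \<and>
     (\<forall>E\<in>\<U>. Id_on X \<subseteq> E \<and> E \<subseteq> X \<times> X) \<and>
     (\<forall>E\<in>\<U>. \<forall>F. E \<subseteq> F \<and> F \<subseteq> X \<times> X \<longrightarrow> F \<in> \<U>) \<and>
     (\<forall>E\<in>\<U>. \<forall>F\<in>\<U>. E \<inter> F \<in> \<U>) \<and>
     (\<forall>E\<in>\<U>. E\<inverse> \<in> \<U>) \<and>
     (\<forall>E\<in>\<U>. \<exists>D\<in>\<U>. D O D \<subseteq> E)"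

definition compatible_uniformity :: "'a topology \<Rightarrow> ('a \<times> 'a) set set \<Rightarrow> bool" where
  "compatible_uniformity T \<U> \<longleftrightarrow>
     uniform_structure (topspace T) \<U> \<and>
     (\<forall>W. openin T W \<longleftrightarrow> W \<subseteq> topspace T \<and> (\<forall>x\<in>W. \<exists>E\<in>\<U>. E `` {x} \<subseteq> W))"

lemma uniform_structureD:
  assumes "uniform_structure X \<U>"
  shows "E \<in> \<U> \<Longrightarrow> Id_on X \<subseteq> E"
    and "E \<in> \<U> \<Longrightarrow> E \<subseteq> X \<times> X"
    and "E \<in> \<U> \<Longrightarrow> E \<subseteq> F \<Longrightarrow> F \<subseteq> X \<times> X \<Longrightarrow> F \<in> \<U>"
    and "E \<in> \<U> \<Longrightarrow> F \<in> \<U> \<Longrightarrow> E \<inter> F \<in> \<U>"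
    and "E \<in> \<U> \<Longrightarrow> E\<inverse> \<in> \<U>"
    and "E \<in> \<U> \<Longrightarrow> \<exists>D\<in>\<U>. D O D \<subseteq> E"
  using assms unfolding uniform_structure_def by meson+

lemma compatible_uniformityD:
  assumes "compatible_uniformity T \<U>"
  shows "uniform_structure (topspace T) \<U>"
    and "openin T W \<longleftrightarrow> W \<subseteq> topspace T \<and> (\<forall>x\<in>W. \<exists>E\<in>\<U>. E `` {x} \<subseteq> W)"
  using assms unfolding compatible_uniformity_def by meson+

lemma compact_space_finite_subcover:
  assumes T: "compact_space T"
    and A: "\<And>x. x \<in> topspace T \<Longrightarrow> openin T (A x) \<and> x \<in> A x"
  obtains F where "finite F" "F \<subseteq> topspace T" "topspace T \<subseteq> (\<Union>x\<in>F. A x)"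
proof -
  have "(\<forall>U\<in>A ` topspace T. openin T U) \<and> topspace T \<subseteq> \<Union>(A ` topspace T)"
    using A by blast
  then obtain \<F> where "finite \<F>" "\<F> \<subseteq> A ` topspace T" "topspace T \<subseteq> \<Union>\<F>"
    using T unfolding compact_space_alt by meson
  then show ?thesis
    using that by (metis finite_subset_image)
qed

lemma open_diagonal_nhd_square:
  assumes "openin (prod_topology T T) W" "Id_on (topspace T) \<subseteq> W" "x \<in> topspace T"
  shows "\<exists>A. openin T A \<and> x \<in> A \<and> A \<times> A \<subseteq> W"
proof -
  have "(x, x) \<in> W" using assms by auto
  then obtain U V where "openin T U" "openin T V" "x \<in> U" "x \<in> V" "U \<times> V \<subseteq> W"
    using assms(1) unfolding openin_prod_topology_alt by meson
  then show ?thesis by (intro exI[of _ "U \<inter> V"]) auto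
qed

lemma uniform_interior:
  assumes U: "compatible_uniformity T \<U>" and E: "E \<in> \<U>" and x: "x \<in> topspace T"
  shows "\<exists>A. openin T A \<and> x \<in> A \<and> A \<subseteq> E `` {x}"
proof -
  define A where "A = {y \<in> topspace T. \<exists>D\<in>\<U>. D `` {y} \<subseteq> E `` {x}}"
  note us = uniform_structureD[OF compatible_uniformityD(1)[OF U]]
  have "x \<in> A" using x E unfolding A_def by auto
  moreover have "A \<subseteq> E `` {x}"
  proof
    fix y assume "y \<in> A"
    then obtain D where D: "y \<in> topspace T" "D \<in> \<U>" "D `` {y} \<subseteq> E `` {x}"
      unfolding A_def by auto
    have "Id_on (topspace T) \<subseteq> D" by (rule us(1)[OF D(2)])
    then have "(y, y) \<in> D" using D(1) by auto
    then show "y \<in> E `` {x}" using D(3) by auto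
  qed
  moreover have "openin T A"
  proof -
    have "\<exists>D\<in>\<U>. D `` {y} \<subseteq> A" if "y \<in> A" for y
    proof -
      obtain D where D: "D \<in> \<U>" "D `` {y} \<subseteq> E `` {x}" using \<open>y \<in> A\<close> unfolding A_def by auto
      obtain D' where D': "D' \<in> \<U>" "D' O D' \<subseteq> D" using us(6)[OF D(1)] by blast
      have sub: "D' \<subseteq> topspace T \<times> topspace T" by (rule us(2)[OF D'(1)])
      have "D' `` {y} \<subseteq> A"
      proof
        fix z assume z: "z \<in> D' `` {y}"
        have "D' `` {z} \<subseteq> E `` {x}" using z D' D(2) by blast
        then show "z \<in> A" using z sub D'(1) unfolding A_def by blast
      qed
      then show ?thesis using D'(1) by blast
    qed
    moreover have "A \<subseteq> topspace T" unfolding A_def by auto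
    ultimately show ?thesis unfolding compatible_uniformityD(2)[OF U] by blast
  qed
  ultimately show ?thesis by blast
qed

lemma uniform_sym_half:
  assumes U: "uniform_structure X \<U>" and E: "E \<in> \<U>"
  obtains D where "D \<in> \<U>" "D\<inverse> = D" "D O D \<subseteq> E" "Id_on X \<subseteq> D" "D \<subseteq> E"
proof -
  note us = uniform_structureD[OF U]
  obtain D where D: "D \<in> \<U>" "D O D \<subseteq> E" using us(6)[OF E] by blast
  have 1: "D \<inter> D\<inverse> \<in> \<U>" by (intro us(4) us(5) D(1))
  have 2: "(D \<inter> D\<inverse>)\<inverse> = D \<inter> D\<inverse>" by auto
  have 3: "(D \<inter> D\<inverse>) O (D \<inter> D\<inverse>) \<subseteq> E" using D(2) by blast
  have 4: "Id_on X \<subseteq> D \<inter> D\<inverse>" by (rule us(1)[OF 1])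
  have 5: "D \<inter> D\<inverse> \<subseteq> X \<times> X" by (rule us(2)[OF 1])
  have 6: "D \<inter> D\<inverse> \<subseteq> E"
  proof
    fix p assume p: "p \<in> D \<inter> D\<inverse>"
    obtain a b where ab: "p = (a, b)" by (cases p)
    have "(b, b) \<in> D \<inter> D\<inverse>" using 4 5 p ab by (auto simp: Id_on_def)
    then show "p \<in> E" using 3 p unfolding ab by blast
  qed
  show thesis using that[OF 1 2 3 4 6] .
qed

lemma uniform_finite_Inter:
  assumes U: "uniform_structure X \<U>" and "finite F" "\<And>x. x \<in> F \<Longrightarrow> D x \<in> \<U>"
  shows "X \<times> X \<inter> (\<Inter>x\<in>F. D x) \<in> \<U>"
  using assms(2,3)
proof (induction F)
  case empty
  have "X \<times> X \<in> \<U>" using U unfolding uniform_structure_def by (elim conjunct1)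
  then show ?case by simp
next
  case (insert x F)
  have "X \<times> X \<inter> (\<Inter>x\<in>insert x F. D x) = D x \<inter> (X \<times> X \<inter> (\<Inter>x\<in>F. D x))" by auto
  moreover have "X \<times> X \<inter> (\<Inter>x\<in>F. D x) \<in> \<U>" "D x \<in> \<U>" using insert by auto
  ultimately show ?case using uniform_structureD(4)[OF U] by metis
qed

lemma compatible_uniformity_unique:
  assumes T: "compact_space T" and U: "compatible_uniformity T \<U>"
  shows "\<U> = {E. E \<subseteq> topspace T \<times> topspace T \<and>
           (\<exists>W. openin (prod_topology T T) W \<and> Id_on (topspace T) \<subseteq> W \<and> W \<subseteq> E)}"
    (is "_ = ?N")
proof (intro equalityI subsetI)
  fix E assume E: "E \<in> \<U>"
  have us: "uniform_structure (topspace T) \<U>" using U compatible_uniformity_def by blast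
  obtain D where D: "D \<in> \<U>" "D\<inverse> = D" "D O D \<subseteq> E" using uniform_sym_half[OF us E] .
  have "\<forall>x\<in>topspace T. \<exists>A. openin T A \<and> x \<in> A \<and> A \<subseteq> D `` {x}"
    using uniform_interior[OF U D(1)] by blast
  then obtain A where A: "\<forall>x\<in>topspace T. openin T (A x) \<and> x \<in> A x \<and> A x \<subseteq> D `` {x}"
    by metis
  let ?W = "\<Union>x\<in>topspace T. A x \<times> A x"
  have "openin (prod_topology T T) ?W" using A by (auto simp: openin_prod_Times_iff)
  moreover have "Id_on (topspace T) \<subseteq> ?W" using A by auto
  moreover have "?W \<subseteq> E"
  proof
    fix p assume "p \<in> ?W"
    then obtain x a b where x: "x \<in> topspace T" "p = (a,b)" "a \<in> A x" "b \<in> A x" by auto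
    then have "(x, a) \<in> D" "(x, b) \<in> D" using A by auto
    then have "(a, x) \<in> D" "(x, b) \<in> D" using D(2) by auto
    then show "p \<in> E" using D(3) x(2) by auto
  qed
  moreover have "E \<subseteq> topspace T \<times> topspace T"
    by (rule uniform_structureD(2)[OF us E])
  ultimately show "E \<in> ?N" by blast
next
  fix E assume "E \<in> ?N"
  then obtain W where W: "openin (prod_topology T T) W" "Id_on (topspace T) \<subseteq> W" "W \<subseteq> E"
    and E: "E \<subseteq> topspace T \<times> topspace T" by blast
  have us: "uniform_structure (topspace T) \<U>" using U compatible_uniformity_def by blast
  have "\<exists>D B A. D \<in> \<U> \<and> D O D \<subseteq> A \<and> A `` {x} \<times> A `` {x} \<subseteq> W \<and> D \<subseteq> A
           \<and> openin T B \<and> x \<in> B \<and> B \<subseteq> D `` {x}"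
    if x: "x \<in> topspace T" for x
  proof -
    obtain A where A: "openin T A" "x \<in> A" "A \<times> A \<subseteq> W"
      using open_diagonal_nhd_square[OF W(1,2) x] by blast
    then obtain F where F: "F \<in> \<U>" "F `` {x} \<subseteq> A"
      using compatible_uniformityD(2)[OF U] by blast
    obtain D where D: "D \<in> \<U>" "D O D \<subseteq> F" "D \<subseteq> F" using uniform_sym_half[OF us F(1)] .
    obtain B where "openin T B" "x \<in> B" "B \<subseteq> D `` {x}"
      using uniform_interior[OF U D(1) x] by blast
    moreover have "F `` {x} \<times> F `` {x} \<subseteq> W" using A(3) F(2) by blast
    ultimately show ?thesis using D by blast
  qed
  then obtain D B A where dba: "\<And>x. x \<in> topspace T \<Longrightarrow> D x \<in> \<U> \<and> D x O D x \<subseteq> A x \<and>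
      A x `` {x} \<times> A x `` {x} \<subseteq> W \<and> D x \<subseteq> A x \<and> openin T (B x) \<and> x \<in> B x \<and> B x \<subseteq> D x `` {x}"
    by metis
  obtain F where F: "finite F" "F \<subseteq> topspace T" "topspace T \<subseteq> (\<Union>x\<in>F. B x)"
    using compact_space_finite_subcover[OF T, of B] dba by blast
  let ?V = "topspace T \<times> topspace T \<inter> (\<Inter>x\<in>F. D x)"
  have V: "?V \<in> \<U>" using uniform_finite_Inter[OF us F(1)] dba F(2) by blast
  have "?V \<subseteq> W"
  proof
    fix p assume p: "p \<in> ?V"
    obtain a b where ab: "p = (a,b)" by (cases p)
    obtain x where x: "x \<in> F" "a \<in> B x" using p ab F(3) by blast
    then have x': "x \<in> topspace T" using F(2) by blast
    have "(a, b) \<in> D x" using p ab x by blast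
    moreover have "(x, a) \<in> D x" using dba[OF x'] x by blast
    ultimately have "(x, a) \<in> A x" "(x, b) \<in> A x" using dba[OF x'] by blast+
    then show "p \<in> W" using dba[OF x'] ab by blast
  qed
  then show "E \<in> \<U>" using uniform_structureD(3)[OF us V _ E] W(3) by blast
qed

lemma compatible_uniformity_exists:
  assumes T: "compact_space T" and H: "Hausdorff_space T"
  shows "compatible_uniformity T {E. E \<subseteq> topspace T \<times> topspace T \<and>
           (\<exists>W. openin (prod_topology T T) W \<and> Id_on (topspace T) \<subseteq> W \<and> W \<subseteq> E)}"
    (is "compatible_uniformity T ?N")
proof -
  let ?X = "topspace T"
  have NI: "E \<in> ?N"
    if "openin (prod_topology T T) W" "Id_on ?X \<subseteq> W" "W \<subseteq> E" "E \<subseteq> ?X \<times> ?X" for E W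
    using that by (intro CollectI conjI exI[of _ W])
  have NE: "\<exists>W. openin (prod_topology T T) W \<and> Id_on ?X \<subseteq> W \<and> W \<subseteq> E \<and> E \<subseteq> ?X \<times> ?X"
    if "E \<in> ?N" for E
    using that by auto
  have reg: "regular_space T"
    using compact_Hausdorff_imp_regular_space[OF T H] .
  have half: "\<exists>D\<in>?N. D O D \<subseteq> E" if E: "E \<in> ?N" for E
  proof -
    obtain W where W: "openin (prod_topology T T) W" "Id_on ?X \<subseteq> W" "W \<subseteq> E"
      using NE[OF E] by (elim exE conjE)
    have "\<exists>A B C. openin T A \<and> A \<times> A \<subseteq> W \<and> openin T B \<and> x \<in> B \<and> closedin T C \<and> B \<subseteq> C \<and> C \<subseteq> A"
      if x: "x \<in> ?X" for x
    proof -
      obtain A where A: "openin T A" "x \<in> A" "A \<times> A \<subseteq> W"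
        using open_diagonal_nhd_square[OF W(1,2) x] by blast
      obtain B C where "openin T B" "closedin T C" "x \<in> B" "B \<subseteq> C" "C \<subseteq> A"
        using reg A unfolding neighbourhood_base_of_closedin[symmetric] neighbourhood_base_of
        by meson
      then show ?thesis using A by blast
    qed
    then obtain A B C where ab: "\<And>x. x \<in> ?X \<Longrightarrow> openin T (A x) \<and> A x \<times> A x \<subseteq> W \<and>
        openin T (B x) \<and> x \<in> B x \<and> closedin T (C x) \<and> B x \<subseteq> C x \<and> C x \<subseteq> A x"
      by metis
    obtain F where F: "finite F" "F \<subseteq> ?X" "?X \<subseteq> (\<Union>x\<in>F. B x)"
      using compact_space_finite_subcover[OF T, of B] ab by blast
    let ?S = "\<lambda>x. (?X - C x) \<times> ?X \<union> ?X \<times> A x"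
    let ?S' = "\<lambda>x. ?X \<times> (?X - C x) \<union> A x \<times> ?X"
    let ?V = "?X \<times> ?X \<inter> (\<Inter>x\<in>F. ?S x \<inter> ?S' x)"
    have op: "openin (prod_topology T T) (?S x \<inter> ?S' x)" if "x \<in> F" for x
    proof -
      have "openin T (A x)" "openin T (?X - C x)"
        using ab[of x] F(2) that by (blast intro: openin_diff[OF openin_topspace])+
      then show ?thesis by (intro openin_Int openin_Un) (simp_all add: openin_prod_Times_iff)
    qed
    have "openin (prod_topology T T) ?V"
    proof (cases "F = {}")
      case True
      then show ?thesis by (auto simp: openin_prod_Times_iff)
    next
      case False
      have "openin (prod_topology T T) (\<Inter>x\<in>F. ?S x \<inter> ?S' x)"
        using F(1) False op by (intro openin_Inter) auto
      then show ?thesis by (intro openin_Int) (auto simp: openin_prod_Times_iff)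
    qed
    moreover have "Id_on ?X \<subseteq> ?V" using ab F(2) by blast
    ultimately have VN: "?V \<in> ?N" by (rule NI) auto
    have "?V O ?V \<subseteq> E"
    proof
      fix p assume "p \<in> ?V O ?V"
      then obtain x y z where p: "p = (x, z)" "(x, y) \<in> ?V" "(y, z) \<in> ?V" by blast
      then have "y \<in> ?X" by blast
      then obtain i where i: "i \<in> F" "y \<in> B i" using F(3) by blast
      then have i': "i \<in> ?X" using F(2) by blast
      have "y \<in> C i" using ab[OF i'] i(2) by blast
      moreover have "(x, y) \<in> ?S' i" "(y, z) \<in> ?S i" using p(2,3) i(1) by blast+
      ultimately have "x \<in> A i" "z \<in> A i" by auto
      then show "p \<in> E" using ab[OF i'] p(1) W(3) by blast
    qed
    then show ?thesis using VN by (rule bexI)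
  qed
  have conv: "E\<inverse> \<in> ?N" if E: "E \<in> ?N" for E
  proof -
    obtain W where W: "openin (prod_topology T T) W" "Id_on ?X \<subseteq> W" "W \<subseteq> E" "E \<subseteq> ?X \<times> ?X"
      using NE[OF E] by (elim exE conjE)
    have "\<exists>U V. openin T U \<and> openin T V \<and> x \<in> U \<and> y \<in> V \<and> U \<times> V \<subseteq> W\<inverse>"
      if xy: "(x, y) \<in> W\<inverse>" for x y
    proof -
      have "(y, x) \<in> W" using xy by simp
      then obtain U V where UV: "openin T U" "openin T V" "y \<in> U" "x \<in> V" "U \<times> V \<subseteq> W"
        using W(1) unfolding openin_prod_topology_alt by meson
      then have "V \<times> U \<subseteq> W\<inverse>" by auto
      then show ?thesis using UV by meson
    qed
    then have "openin (prod_topology T T) (W\<inverse>)"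
      unfolding openin_prod_topology_alt by (intro allI impI)
    moreover have "Id_on ?X \<subseteq> W\<inverse>" using W(2) by auto
    moreover have "W\<inverse> \<subseteq> E\<inverse>" using W(3) by auto
    moreover have "E\<inverse> \<subseteq> ?X \<times> ?X" using W(4) by auto
    ultimately show ?thesis by (rule NI)
  qed
  have int: "E \<inter> F \<in> ?N" if E: "E \<in> ?N" and F: "F \<in> ?N" for E F
  proof -
    obtain W where W: "openin (prod_topology T T) W" "Id_on ?X \<subseteq> W" "W \<subseteq> E" "E \<subseteq> ?X \<times> ?X"
      using NE[OF E] by (elim exE conjE)
    obtain W' where W': "openin (prod_topology T T) W'" "Id_on ?X \<subseteq> W'" "W' \<subseteq> F"
      using NE[OF F] by (elim exE conjE)
    show ?thesis
      by (rule NI[of "W \<inter> W'"]) (use W W' in auto)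
  qed
  have up: "F \<in> ?N" if E: "E \<in> ?N" and "E \<subseteq> F" "F \<subseteq> ?X \<times> ?X" for E F
  proof -
    obtain W where W: "openin (prod_topology T T) W" "Id_on ?X \<subseteq> W" "W \<subseteq> E"
      using NE[OF E] by (elim exE conjE)
    show ?thesis
      using NI[OF W(1,2) order_trans[OF W(3) that(2)] that(3)] .
  qed
  have top: "?X \<times> ?X \<in> ?N"
    by (rule NI[of "?X \<times> ?X"]) (auto simp: openin_prod_Times_iff)
  have diag: "Id_on ?X \<subseteq> E \<and> E \<subseteq> ?X \<times> ?X" if "E \<in> ?N" for E
    using NE[OF that] by (meson order_trans)
  have us: "uniform_structure ?X ?N"
    unfolding uniform_structure_def
    by (intro conjI ballI allI impI; (elim conjE)?; (rule top diag[THEN conjunct1]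
        diag[THEN conjunct2] int conv half up); assumption?)
  have "openin T W \<longleftrightarrow> W \<subseteq> ?X \<and> (\<forall>x\<in>W. \<exists>E\<in>?N. E `` {x} \<subseteq> W)" for W
  proof
    assume W: "openin T W"
    have "\<exists>E\<in>?N. E `` {x} \<subseteq> W" if x: "x \<in> W" for x
    proof -
      have xX: "x \<in> ?X" using W x openin_subset by blast
      let ?E = "(?X - {x}) \<times> ?X \<union> ?X \<times> W"
      have "openin T (?X - {x})"
        using Hausdorff_imp_t1_space[OF H] xX by (simp add: t1_space_openin_delete_alt openin_delete)
      then have "openin (prod_topology T T) ?E"
        using W by (intro openin_Un) (auto simp: openin_prod_Times_iff)
      moreover have "Id_on ?X \<subseteq> ?E" "?E \<subseteq> ?X \<times> ?X" using x openin_subset[OF W] by auto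
      ultimately have "?E \<in> ?N" by (intro NI[of ?E]) auto
      moreover have "?E `` {x} \<subseteq> W" by auto
      ultimately show ?thesis by (rule bexI[rotated])
    qed
    then show "W \<subseteq> ?X \<and> (\<forall>x\<in>W. \<exists>E\<in>?N. E `` {x} \<subseteq> W)" using openin_subset[OF W] by blast
  next
    assume R: "W \<subseteq> ?X \<and> (\<forall>x\<in>W. \<exists>E\<in>?N. E `` {x} \<subseteq> W)"
    have "\<exists>V. openin T V \<and> x \<in> V \<and> V \<subseteq> W" if x: "x \<in> W" for x
    proof -
      obtain E G where E: "E `` {x} \<subseteq> W" "openin (prod_topology T T) G" "Id_on ?X \<subseteq> G" "G \<subseteq> E"
        using R x by blast
      have "x \<in> ?X" using R x by blast
      then have "(x, x) \<in> G" using E(3) by auto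
      then obtain U V where "openin T U" "openin T V" "x \<in> U" "x \<in> V" "U \<times> V \<subseteq> G"
        using E(2) unfolding openin_prod_topology_alt by meson
      then show ?thesis using E(1,4) by blast
    qed
    then show "openin T W" by (subst openin_subopen) blast
  qed
  then show ?thesis using us unfolding compatible_uniformity_def by blast
qed

lemma compact_Hausdorff_ex1_uniformity:
  assumes "compact_space T" "Hausdorff_space T"
  shows "\<exists>!\<U>. compatible_uniformity T \<U>"
  by (rule ex1I, rule compatible_uniformity_exists[OF assms])
    (rule compatible_uniformity_unique[OF assms(1)])

text \<open>Meaningful for compact Hausdorff \<open>T\<close> only, by \<open>compact_Hausdorff_ex1_uniformity\<close>.\<close>

definition the_uniformity :: "'a topology \<Rightarrow> ('a \<times> 'a) set set" where
  "the_uniformity T = (THE \<U>. compatible_uniformity T \<U>)"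

lemma the_uniformity_compatible:
  assumes "compact_space T" "Hausdorff_space T"
  shows "compatible_uniformity T (the_uniformity T)"
  unfolding the_uniformity_def
  using theI'[OF compact_Hausdorff_ex1_uniformity[OF assms]] .

text \<open>A map into the carrier \<open>Y\<close> of the uniformity \<open>\<U>\<close>; as entourages are subsets of
  \<open>Y \<times> Y\<close>, every fragmented \<open>f\<close> maps \<open>topspace T\<close> into \<open>Y\<close>.\<close>

definition fragmented_map :: "'a topology \<Rightarrow> ('b \<times> 'b) set set \<Rightarrow> ('a \<Rightarrow> 'b) \<Rightarrow> bool" where
  "fragmented_map T \<U> f \<longleftrightarrow>
     (\<forall>A E. A \<subseteq> topspace T \<and> A \<noteq> {} \<and> E \<in> \<U> \<longrightarrow>
        (\<exists>V. openin T V \<and> V \<inter> A \<noteq> {} \<and> f ` (V \<inter> A) \<times> f ` (V \<inter> A) \<subseteq> E))"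


section \<open>Right topological semigroups and groups\<close>

text \<open>The record field \<open>one\<close> plays no role for semigroups.\<close>

definition right_topological_semigroup ::
    "('a, 'b) monoid_scheme \<Rightarrow> 'a topology \<Rightarrow> bool" where
  "right_topological_semigroup P T \<longleftrightarrow>
     topspace T = carrier P \<and> Hausdorff_space T \<and>
     (\<forall>x\<in>carrier P. \<forall>y\<in>carrier P. x \<otimes>\<^bsub>P\<^esub> y \<in> carrier P) \<and>
     (\<forall>x\<in>carrier P. \<forall>y\<in>carrier P. \<forall>z\<in>carrier P.
        (x \<otimes>\<^bsub>P\<^esub> y) \<otimes>\<^bsub>P\<^esub> z = x \<otimes>\<^bsub>P\<^esub> (y \<otimes>\<^bsub>P\<^esub> z)) \<and>
     (\<forall>a\<in>carrier P. continuous_map T T (\<lambda>x. x \<otimes>\<^bsub>P\<^esub> a))"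

definition right_topological_group ::
    "('a, 'b) monoid_scheme \<Rightarrow> 'a topology \<Rightarrow> bool" where
  "right_topological_group P T \<longleftrightarrow> group P \<and> right_topological_semigroup P T"

definition topological_group :: "('a, 'b) monoid_scheme \<Rightarrow> 'a topology \<Rightarrow> bool" where
  "topological_group P T \<longleftrightarrow>
     group P \<and> topspace T = carrier P \<and> Hausdorff_space T \<and>
     continuous_map (prod_topology T T) T (\<lambda>(x, y). x \<otimes>\<^bsub>P\<^esub> y) \<and>
     continuous_map T T (\<lambda>x. inv\<^bsub>P\<^esub> x)"

definition topological_center ::
    "('a, 'b) monoid_scheme \<Rightarrow> 'a topology \<Rightarrow> 'a set" where
  "topological_center P T = {a \<in> carrier P. continuous_map T T (\<lambda>x. a \<otimes>\<^bsub>P\<^esub> x)}"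

definition admissible :: "('a, 'b) monoid_scheme \<Rightarrow> 'a topology \<Rightarrow> bool" where
  "admissible P T \<longleftrightarrow> Abstract_Topology.closure_of T (topological_center P T) = topspace T"

definition tame :: "('a, 'b) monoid_scheme \<Rightarrow> 'a topology \<Rightarrow> bool" where
  "tame P T \<longleftrightarrow>
     right_topological_semigroup P T \<and> compact_space T \<and> admissible P T \<and>
     (\<forall>a\<in>carrier P. fragmented_map T (the_uniformity T) (\<lambda>x. a \<otimes>\<^bsub>P\<^esub> x))"

end

theory Submission
  imports Defs
begin

text \<open>
  Everything rests on joint continuity of the multiplication of \<open>P\<close>; inversion then has a closed
  graph in a compact space and is continuous for free. Since the topology is given by the
  continuous real functions \<open>f\<close>, and right translations are homeomorphisms, it suffices to bound,
  for every \<open>f\<close> and every \<open>a\<close>, the oscillation of \<open>f (b \<otimes> _)\<close> on one neighbourhood of \<open>\<one>\<close>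
  simultaneously for all \<open>b\<close> near \<open>a\<close>. Call a product \<open>U \<times> N\<close> of open sets small if this
  oscillation on \<open>N\<close> is at most \<open>e\<close> for all \<open>b \<in> U\<close>.

  Small products are dense (\<open>small_oscillation_dense\<close>), and this is where tameness enters. Otherwise
  one constructs countable sets \<open>A\<close> of points and \<open>S\<close> of elements of the topological centre, and a
  cluster point \<open>a\<close> of \<open>S\<close>, such that every point of \<open>A\<close> is approximated by points of \<open>A\<close> with
  respect to all the functions \<open>f (s \<otimes> _)\<close>, \<open>s \<in> S\<close>, on which \<open>f (a \<otimes> _)\<close> differs from its value
  there by at least \<open>e / 2\<close>. But \<open>f (a \<otimes> _)\<close> is a pointwise limit of the \<open>f (s \<otimes> _)\<close>, hence factors
  through them, and it is fragmented; this is contradictory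
  (\<open>fragmented_factor_almost_continuous\<close>). Metrizability is nowhere available, so the usual
  argument with points of continuity of a single map does not apply, and the factor through
  countably many functions takes its place.

  Density is then moved to \<open>\<one>\<close>. Finitely many right translates of a nonempty open set cover \<open>P\<close>,
  so a small product can be found whose elements multiply into a given open set; moving a centre
  element across the product gives small \<open>U \<times> N\<close> with \<open>\<one> \<in> N\<close> and \<open>U\<close> inside any given
  open set (\<open>small_oscillation_at_one_dense\<close>).

  The last step reaches every \<open>a\<close>. If \<open>f x\<close> and \<open>f y\<close> differ by at least \<open>e\<close>, then the elements \<open>r\<close>
  for which \<open>f (r \<otimes> x)\<close> and \<open>f (r \<otimes> y)\<close> differ by more than \<open>e / 2\<close> form an open set, and some such
  \<open>r\<close> in the centre carries \<open>a\<close> into the first factor of an \<open>e / 2\<close>-small product. Hence points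
  \<open>b \<otimes> u\<close> and \<open>b \<otimes> w\<close> with \<open>b\<close> near \<open>a\<close> and \<open>u\<close>, \<open>w\<close> near \<open>\<one>\<close> cannot approach \<open>(x, y)\<close>, and
  compactness of \<open>P \<times> P\<close> makes this uniform in \<open>(x, y)\<close> (\<open>small_oscillation_at_one\<close>).
\<close>

section \<open>Fragmented real functions\<close>

definition real_fragmented :: "'a topology \<Rightarrow> ('a \<Rightarrow> real) \<Rightarrow> bool" where
  "real_fragmented T k \<longleftrightarrow>
     (\<forall>A e. A \<subseteq> topspace T \<and> A \<noteq> {} \<and> e > 0 \<longrightarrow>
        (\<exists>V. openin T V \<and> V \<inter> A \<noteq> {} \<and> (\<forall>x\<in>V \<inter> A. \<forall>y\<in>V \<inter> A. \<bar>k x - k y\<bar> < e)))"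

lemma real_fragmentedD:
  assumes "real_fragmented T k" "A \<subseteq> topspace T" "A \<noteq> {}" "e > 0"
  obtains V where "openin T V" "V \<inter> A \<noteq> {}"
    "\<And>x y. x \<in> V \<inter> A \<Longrightarrow> y \<in> V \<inter> A \<Longrightarrow> \<bar>k x - k y\<bar> < e"
  using assms unfolding real_fragmented_def by meson

lemma openin_real_less:
  assumes "continuous_map T euclideanreal f"
  shows "openin T {x \<in> topspace T. f x < c}"
  using assms by (simp add: continuous_map_upper_lower_semicontinuous_lt)

lemma openin_real_greater:
  assumes "continuous_map T euclideanreal f"
  shows "openin T {x \<in> topspace T. f x > c}"
  using assms by (simp add: continuous_map_upper_lower_semicontinuous_lt)

lemma closedin_real_le:
  assumes "continuous_map T euclideanreal f"
  shows "closedin T {x \<in> topspace T. f x \<le> c}"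
  using assms by (simp add: continuous_map_upper_lower_semicontinuous_le)

lemma closedin_real_ge:
  assumes "continuous_map T euclideanreal f"
  shows "closedin T {x \<in> topspace T. f x \<ge> c}"
  using assms by (simp add: continuous_map_upper_lower_semicontinuous_le)

lemma openin_real_close:
  assumes "continuous_map T euclideanreal f"
  shows "openin T {x \<in> topspace T. \<bar>f x - c\<bar> < e}"
  by (intro openin_real_less continuous_intros assms) auto

text \<open>Composing with real functions removes uniformities from the argument: the points where \<open>f\<close>
  differs by less than \<open>e\<close> form an open neighbourhood of the diagonal, and in a compact Hausdorff
  space every such neighbourhood is an entourage.\<close>

lemma real_fragmented_comp:
  assumes T: "compact_space T" "Hausdorff_space T"
    and h: "fragmented_map T (the_uniformity T) h"
    and f: "continuous_map T euclideanreal f"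
  shows "real_fragmented T (f \<circ> h)"
  unfolding real_fragmented_def
proof (intro allI impI, elim conjE)
  fix A and e :: real
  assume A: "A \<subseteq> topspace T" "A \<noteq> {}" and e: "e > 0"
  define E where "E = {p \<in> topspace (prod_topology T T). \<bar>f (fst p) - f (snd p)\<bar> < e}"
  have "openin (prod_topology T T) E"
    unfolding E_def
    by (intro openin_real_less continuous_intros continuous_map_compose[OF _ f, unfolded o_def]
        continuous_map_fst continuous_map_snd)
  moreover have "Id_on (topspace T) \<subseteq> E" using e by (auto simp: E_def)
  ultimately have "E \<in> the_uniformity T"
    unfolding compatible_uniformity_unique[OF T(1) the_uniformity_compatible[OF T]]
    by (auto simp: E_def)
  then obtain V where "openin T V" "V \<inter> A \<noteq> {}" "h ` (V \<inter> A) \<times> h ` (V \<inter> A) \<subseteq> E"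
    using h A unfolding fragmented_map_def by meson
  moreover have "\<bar>(f \<circ> h) x - (f \<circ> h) y\<bar> < e" if "x \<in> V \<inter> A" "y \<in> V \<inter> A" for x y
  proof -
    have "(h x, h y) \<in> E" using calculation(3) that by blast
    then show ?thesis by (simp add: E_def)
  qed
  ultimately show "\<exists>V. openin T V \<and> V \<inter> A \<noteq> {} \<and>
      (\<forall>x\<in>V \<inter> A. \<forall>y\<in>V \<inter> A. \<bar>(f \<circ> h) x - (f \<circ> h) y\<bar> < e)"
    by blast
qed

text \<open>Zorn's lemma for the complements: by compactness, a chain of open sets none of which contains
  \<open>C\<close> has a union which does not contain \<open>C\<close> either.\<close>

lemma minimal_closed_transversal:
  assumes T: "compact_space T"
    and C: "\<forall>C\<in>\<C>. closedin T C \<and> C \<noteq> {}"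
  shows "\<exists>Z. closedin T Z \<and> (\<forall>C\<in>\<C>. Z \<inter> C \<noteq> {}) \<and>
    (\<forall>Y. closedin T Y \<and> Y \<subseteq> Z \<and> (\<forall>C\<in>\<C>. Y \<inter> C \<noteq> {}) \<longrightarrow> Y = Z)"
proof -
  define \<A> where "\<A> = {V. openin T V \<and> (\<forall>C\<in>\<C>. \<not> C \<subseteq> V)}"
  have "\<exists>M\<in>\<A>. \<forall>X\<in>\<A>. M \<subseteq> X \<longrightarrow> X = M"
  proof (rule subset_Zorn_nonempty)
    show "\<A> \<noteq> {}" using C by (auto simp: \<A>_def intro!: exI[of _ "{}"])
  next
    fix \<D> assume D: "\<D> \<noteq> {}" "subset.chain \<A> \<D>"
    have D1: "V \<in> \<A>" if "V \<in> \<D>" for V using D(2) that by (auto simp: subset.chain_def)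
    have "\<not> C \<subseteq> \<Union>\<D>" if "C \<in> \<C>" for C
    proof
      assume sub: "C \<subseteq> \<Union>\<D>"
      have "compactin T C" using T C[rule_format, OF that] closedin_compact_space by blast
      then obtain \<F> where F: "finite \<F>" "\<F> \<subseteq> \<D>" "C \<subseteq> \<Union>\<F>"
        using compactinD[of T C \<D>] sub D1 by (auto simp: \<A>_def)
      have "\<F> \<noteq> {}" using F(3) C[rule_format, OF that] by fastforce
      moreover have "subset.chain \<A> \<F>" using D(2) F(2) by (simp add: subset_chain_def subset_iff)
      ultimately have "\<Union>\<F> \<in> \<F>" by (intro Union_in_chain F(1))
      then have "\<Union>\<F> \<in> \<A>" using F(2) by (intro D1) (rule subsetD)
      then show False using F(3) that by (simp add: \<A>_def)
    qed
    then show "\<Union>\<D> \<in> \<A>" using D1 by (auto simp: \<A>_def)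
  qed
  then obtain M where M: "M \<in> \<A>" "\<And>X. X \<in> \<A> \<Longrightarrow> M \<subseteq> X \<Longrightarrow> X = M" by blast
  show ?thesis
  proof (intro exI conjI allI impI ballI)
    show "closedin T (topspace T - M)" using M(1) by (auto simp: \<A>_def)
    show "(topspace T - M) \<inter> C \<noteq> {}" if "C \<in> \<C>" for C
      using M(1) that C[rule_format, OF that] closedin_subset[of T C] by (auto simp: \<A>_def)
    fix Y assume "closedin T Y \<and> Y \<subseteq> topspace T - M \<and> (\<forall>C\<in>\<C>. Y \<inter> C \<noteq> {})"
    then have Y: "closedin T Y" "Y \<subseteq> topspace T - M" "\<forall>C\<in>\<C>. Y \<inter> C \<noteq> {}" by auto
    have "topspace T - Y \<in> \<A>" using Y(1,3) by (auto simp: \<A>_def)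
    moreover have "M \<subseteq> topspace T - Y" using Y(2) M(1) openin_subset by (auto simp: \<A>_def)
    ultimately have "topspace T - Y = M" by (rule M(2))
    then show "Y = topspace T - M" using closedin_subset[OF Y(1)] by auto
  qed
qed

text \<open>Fragmentability passes to quotients of compact spaces, here the quotient by the fibres of the
  family \<open>g\<close>. The idea is to choose a minimal closed set \<open>Z\<close> that meets the fibre of every point
  of \<open>A\<close>, and an open \<open>V\<close> meeting \<open>Z\<close> such that \<open>k\<close> is \<open>e\<close>-small on \<open>V \<inter> Z\<close>. By minimality some
  fibre meets \<open>Z\<close> only inside \<open>V\<close>, and by compactness the same holds for all sufficiently close
  fibres.\<close>

lemma fragmented_factor_almost_continuous:
  fixes g :: "'b \<Rightarrow> 'a \<Rightarrow> real" and k :: "'a \<Rightarrow> real"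
  assumes T: "compact_space T"
    and A: "A \<subseteq> topspace T" "A \<noteq> {}"
    and g: "\<forall>s\<in>S. continuous_map T euclideanreal (g s)"
    and k: "real_fragmented T k"
    and factor: "\<forall>x\<in>topspace T. \<forall>y\<in>topspace T. (\<forall>s\<in>S. g s x = g s y) \<longrightarrow> k x = k y"
    and e: "e > 0"
  shows "\<exists>x\<in>A. \<exists>F d. finite F \<and> F \<subseteq> S \<and> d > 0 \<and>
    (\<forall>y\<in>A. (\<forall>s\<in>F. \<bar>g s x - g s y\<bar> < d) \<longrightarrow> \<bar>k x - k y\<bar> < e)"
proof -
  define C where "C x = {z \<in> topspace T. \<forall>s\<in>S. g s z = g s x}" for x
  have cl: "closedin T {z \<in> topspace T. \<bar>g s z - c\<bar> \<le> 0}" if "s \<in> S" for s c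
    by (intro closedin_real_le continuous_intros g[rule_format] that) auto
  have "closedin T (C x)" for x
  proof -
    have "C x = \<Inter>(insert (topspace T) ((\<lambda>s. {z \<in> topspace T. \<bar>g s z - g s x\<bar> \<le> 0}) ` S))"
      by (auto simp: C_def)
    moreover have "closedin T D"
      if "D \<in> insert (topspace T) ((\<lambda>s. {z \<in> topspace T. \<bar>g s z - g s x\<bar> \<le> 0}) ` S)" for D
      using that by (elim insertE imageE) (simp, simp only: cl)
    ultimately show ?thesis by (simp only:) (rule closedin_Inter; blast)
  qed
  then have "\<forall>D\<in>C ` A. closedin T D \<and> D \<noteq> {}"
    using A by (auto simp: C_def)
  from minimal_closed_transversal[OF T this]
  obtain Z where Z: "closedin T Z" "\<forall>D\<in>C ` A. Z \<inter> D \<noteq> {}"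
    "\<forall>Y. closedin T Y \<and> Y \<subseteq> Z \<and> (\<forall>D\<in>C ` A. Y \<inter> D \<noteq> {}) \<longrightarrow> Y = Z"
    by (elim exE conjE)
  have "Z \<noteq> {}" using Z(2) A by auto
  then obtain V where V: "openin T V" "V \<inter> Z \<noteq> {}"
    "\<And>x y. x \<in> V \<inter> Z \<Longrightarrow> y \<in> V \<inter> Z \<Longrightarrow> \<bar>k x - k y\<bar> < e"
    using real_fragmentedD[OF k closedin_subset[OF Z(1)] _ e] by blast
  have clZV: "closedin T (Z - V)" using Z(1) V(1) by (rule closedin_diff)
  obtain x where x: "x \<in> A" "(Z - V) \<inter> C x = {}"
    using Z(3)[rule_format, of "Z - V"] clZV V(2) by fastforce
  \<comment> \<open>Each point of the compact set \<open>Z - V\<close> is separated from \<open>x\<close> by one \<open>g s\<close>, with a margin;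
    finitely many of these conditions suffice for all of \<open>Z - V\<close>.\<close>
  have "\<exists>s d. s \<in> S \<and> d > 0 \<and> d < \<bar>g s z - g s x\<bar>" if "z \<in> Z - V" for z
  proof -
    have "z \<notin> C x" "z \<in> topspace T" using that x(2) closedin_subset[OF Z(1)] by auto
    then obtain s where "s \<in> S" "g s z \<noteq> g s x" by (auto simp: C_def)
    then show ?thesis using dense[of 0 "\<bar>g s z - g s x\<bar>"] by auto
  qed
  then obtain \<sigma> \<delta> where \<sigma>: "\<And>z. z \<in> Z - V \<Longrightarrow> \<sigma> z \<in> S"
    and \<delta>: "\<And>z. z \<in> Z - V \<Longrightarrow> \<delta> z > 0 \<and> \<delta> z < \<bar>g (\<sigma> z) z - g (\<sigma> z) x\<bar>"
    by metis
  define N where "N z = (if z \<in> Z - V then {w \<in> topspace T. \<delta> z < \<bar>g (\<sigma> z) w - g (\<sigma> z) x\<bar>}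
    else topspace T - (Z - V))" for z
  have "openin T (N z) \<and> z \<in> N z" if "z \<in> topspace T" for z
  proof (cases "z \<in> Z - V")
    case True
    have "openin T {w \<in> topspace T. \<delta> z < \<bar>g (\<sigma> z) w - g (\<sigma> z) x\<bar>}"
      by (intro openin_real_greater continuous_intros g[rule_format] \<sigma> True) auto
    then show ?thesis using True \<delta>[OF True] that by (simp add: N_def)
  next
    case False
    then have "N z = topspace T - (Z - V)" unfolding N_def by (rule if_not_P)
    then show ?thesis using clZV that False by (simp add: openin_diff)
  qed
  then obtain Y where Y: "finite Y" "Y \<subseteq> topspace T" "topspace T \<subseteq> (\<Union>z\<in>Y. N z)"
    by (rule compact_space_finite_subcover[OF T])
  define F where "F = \<sigma> ` (Y \<inter> (Z - V))"
  define d where "d = Min (insert 1 (\<delta> ` (Y \<inter> (Z - V))))"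
  have F: "finite F" "F \<subseteq> S" using Y(1) \<sigma> by (auto simp: F_def)
  have d: "d > 0" using Y(1) \<delta> by (auto simp: d_def)
  have far: "\<exists>s\<in>F. d \<le> \<bar>g s x - g s z\<bar>" if "z \<in> Z - V" for z
  proof -
    have "z \<in> topspace T" using that closedin_subset[OF Z(1)] by auto
    then obtain w where w: "w \<in> Y" "z \<in> N w" using Y(3) by auto
    have wZ: "w \<in> Z - V" using w(2) that by (auto simp: N_def split: if_splits)
    have "d \<le> \<delta> w" using w(1) wZ Y(1) by (auto simp: d_def)
    moreover have "\<delta> w < \<bar>g (\<sigma> w) z - g (\<sigma> w) x\<bar>" using w(2) wZ by (simp add: N_def)
    ultimately show ?thesis using w(1) wZ by (intro bexI[of _ "\<sigma> w"]) (auto simp: F_def)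
  qed
  have "\<bar>k x - k y\<bar> < e" if y: "y \<in> A" "\<forall>s\<in>F. \<bar>g s x - g s y\<bar> < d" for y
  proof -
    obtain z where z: "z \<in> Z" "z \<in> C x" using Z(2) x(1) by auto
    obtain w where w: "w \<in> Z" "w \<in> C y" using Z(2) y(1) by auto
    have "z \<in> V" using z x(2) by auto
    moreover have "w \<in> V"
    proof (rule ccontr)
      assume "w \<notin> V"
      then obtain s where "s \<in> F" "d \<le> \<bar>g s x - g s w\<bar>" using far[of w] w(1) by auto
      then show False using y(2)[rule_format, of s] w(2) F(2) by (auto simp: C_def)
    qed
    moreover have "k z = k x" "k w = k y"
      using z w x(1) y(1) A(1) by (auto simp: C_def intro!: factor[rule_format])
    ultimately show ?thesis using V(3)[of z w] z w by auto
  qed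
  then show ?thesis using x(1) F d by blast
qed


section \<open>Right translations and the topological centre\<close>

text \<open>Tameness in the form in which it is used, with continuous real functions in the place of the
  uniformity.\<close>

locale fragmented_group = group P for P (structure) +
  fixes T :: "'a topology"
  assumes topspace_eq: "topspace T = carrier P"
    and Hausdorff: "Hausdorff_space T"
    and compact: "compact_space T"
    and right_continuous: "a \<in> carrier P \<Longrightarrow> continuous_map T T (\<lambda>x. x \<otimes> a)"
    and center_dense: "Abstract_Topology.closure_of T (topological_center P T) = topspace T"
    and left_fragmented: "a \<in> carrier P \<Longrightarrow> continuous_map T euclideanreal f \<Longrightarrow>
           real_fragmented T (\<lambda>x. f (a \<otimes> x))"
begin

lemma openin_carrier: "openin T U \<Longrightarrow> x \<in> U \<Longrightarrow> x \<in> carrier P"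
  using openin_subset topspace_eq by blast

lemma center_carrier: "s \<in> topological_center P T \<Longrightarrow> s \<in> carrier P"
  by (simp add: topological_center_def)

lemma center_left_continuous: "s \<in> topological_center P T \<Longrightarrow> continuous_map T T (\<lambda>x. s \<otimes> x)"
  by (simp add: topological_center_def)

lemma center_meets_open:
  assumes "openin T U" "U \<noteq> {}"
  obtains s where "s \<in> topological_center P T" "s \<in> U"
proof -
  obtain x where x: "x \<in> U" using assms by auto
  then have "x \<in> Abstract_Topology.closure_of T (topological_center P T)"
    using center_dense openin_subset[OF assms(1)] by auto
  then show thesis using x assms(1) that by (auto simp: in_closure_of)
qed

lemma right_continuous_real:
  assumes "a \<in> carrier P" "continuous_map T euclideanreal f"
  shows "continuous_map T euclideanreal (\<lambda>x. f (x \<otimes> a))"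
  using continuous_map_compose[OF right_continuous[OF assms(1)] assms(2)] by (simp add: o_def)

lemma left_continuous_real:
  assumes "s \<in> topological_center P T" "continuous_map T euclideanreal f"
  shows "continuous_map T euclideanreal (\<lambda>x. f (s \<otimes> x))"
  using continuous_map_compose[OF center_left_continuous[OF assms(1)] assms(2)] by (simp add: o_def)

lemma openin_right_preimage:
  assumes "openin T V" "a \<in> carrier P"
  shows "openin T {x \<in> carrier P. x \<otimes> a \<in> V}"
  using openin_continuous_map_preimage[OF right_continuous[OF assms(2)] assms(1)]
  by (simp add: topspace_eq)

lemma openin_left_preimage:
  assumes "openin T V" "s \<in> topological_center P T"
  shows "openin T {x \<in> carrier P. s \<otimes> x \<in> V}"
  using openin_continuous_map_preimage[OF center_left_continuous[OF assms(2)] assms(1)]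
  by (simp add: topspace_eq)

lemma right_translate_open:
  assumes V: "openin T V" and a: "a \<in> carrier P"
  shows "openin T ((\<lambda>x. x \<otimes> a) ` V)"
proof -
  have "(\<lambda>x. x \<otimes> a) ` V = {x \<in> carrier P. x \<otimes> inv a \<in> V}"
  proof (intro equalityI subsetI)
    fix y assume "y \<in> (\<lambda>x. x \<otimes> a) ` V"
    then show "y \<in> {x \<in> carrier P. x \<otimes> inv a \<in> V}"
      using openin_carrier[OF V] a by (auto simp: m_assoc)
  next
    fix y assume y: "y \<in> {x \<in> carrier P. x \<otimes> inv a \<in> V}"
    then have "y = (y \<otimes> inv a) \<otimes> a" using a by (simp add: m_assoc)
    then show "y \<in> (\<lambda>x. x \<otimes> a) ` V" using y by blast
  qed
  then show ?thesis using openin_right_preimage[OF V, of "inv a"] a by simp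
qed

lemma separating_function:
  assumes "openin T V" "x \<in> V"
  obtains f where "continuous_map T euclideanreal f" "f x = 1" "\<forall>y\<in>carrier P - V. f y = 0"
proof -
  have "completely_regular_space T"
    using compact Hausdorff compact_Hausdorff_or_regular_imp_normal_space
      normal_imp_completely_regular_space by blast
  then have "\<forall>S x. openin T S \<longrightarrow> x \<in> S \<longrightarrow>
      (\<exists>f. continuous_map T euclideanreal f \<and> f x = 1 \<and> f ` (topspace T - S) \<subseteq> {0})"
    by (subst (asm) completely_regular_space_gen_alt'[of 1 0]) auto
  from this[rule_format, OF assms]
  obtain f where "continuous_map T euclideanreal f" "f x = 1" "f ` (topspace T - V) \<subseteq> {0}"
    by (elim exE conjE)
  then show thesis using that topspace_eq by blast
qed

section \<open>Density of products with small oscillation\<close>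

definition small_oscillation :: "('a \<Rightarrow> real) \<Rightarrow> real \<Rightarrow> 'a set \<Rightarrow> 'a set \<Rightarrow> bool" where
  "small_oscillation f e U W \<longleftrightarrow> (\<forall>a\<in>U. \<forall>x\<in>W. \<forall>y\<in>W. \<bar>f (a \<otimes> x) - f (a \<otimes> y)\<bar> \<le> e)"

lemma small_oscillation_mono:
  "small_oscillation f e U W \<Longrightarrow> U' \<subseteq> U \<Longrightarrow> W' \<subseteq> W \<Longrightarrow> small_oscillation f e U' W'"
  unfolding small_oscillation_def by blast

text \<open>The negation of density of small products, below \<open>U0 \<times> W0\<close>; it is the standing hypothesis of
  the construction that leads to a contradiction.\<close>

definition nowhere_small :: "('a \<Rightarrow> real) \<Rightarrow> real \<Rightarrow> 'a set \<Rightarrow> 'a set \<Rightarrow> bool" where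
  "nowhere_small f e U0 W0 \<longleftrightarrow>
     (\<forall>U W. openin T U \<and> U \<noteq> {} \<and> U \<subseteq> U0 \<and> openin T W \<and> W \<noteq> {} \<and> W \<subseteq> W0 \<longrightarrow>
        \<not> small_oscillation f e U W)"

text \<open>One step of the construction. The bound \<open>e / 2\<close> arises because two points of a neighbourhood
  of \<open>x\<close> that are separated by \<open>e\<close> cannot both be \<open>e / 2\<close>-close to \<open>x\<close>. The set of \<open>u\<close> separating
  \<open>x\<close> from \<open>y\<close> is open for arbitrary \<open>x\<close> and \<open>y\<close>, as right translations are continuous; the
  elements of \<open>S\<close> must lie in the centre for the neighbourhood of \<open>x\<close> to be open.\<close>

lemma separate_nearby_point:
  assumes f: "continuous_map T euclideanreal f" and e: "e > 0"
    and bad: "nowhere_small f e U0 W0"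
    and W0: "openin T W0"
    and U: "openin T U" "U \<noteq> {}" "U \<subseteq> U0"
    and S: "finite S" "S \<subseteq> topological_center P T" and x: "x \<in> W0" and d: "d > 0"
  shows "\<exists>y U'. y \<in> W0 \<and> openin T U' \<and> U' \<noteq> {} \<and> U' \<subseteq> U \<and>
    (\<forall>s\<in>S. \<bar>f (s \<otimes> x) - f (s \<otimes> y)\<bar> < d) \<and>
    (\<forall>u\<in>U'. e / 2 \<le> \<bar>f (u \<otimes> x) - f (u \<otimes> y)\<bar>)"
proof -
  define W where "W = W0 \<inter> (\<Inter>s\<in>S. {y \<in> topspace T. \<bar>f (s \<otimes> y) - f (s \<otimes> x)\<bar> < d})"
  have "openin T (\<Inter>(insert W0 ((\<lambda>s. {y \<in> topspace T. \<bar>f (s \<otimes> y) - f (s \<otimes> x)\<bar> < d}) ` S)))"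
    using S W0 by (intro openin_Inter) (auto intro!: openin_real_close left_continuous_real f)
  then have W: "openin T W" by (simp add: W_def)
  have xW: "x \<in> W" using x d openin_subset[OF W0] by (auto simp: W_def)
  have "W \<noteq> {}" "W \<subseteq> W0" using xW by (auto simp: W_def)
  then obtain a y z where ayz: "a \<in> U" "y \<in> W" "z \<in> W" "e < \<bar>f (a \<otimes> y) - f (a \<otimes> z)\<bar>"
    using bad U W unfolding nowhere_small_def small_oscillation_def by (meson not_le)
  then have "e / 2 < \<bar>f (a \<otimes> x) - f (a \<otimes> y)\<bar> \<or> e / 2 < \<bar>f (a \<otimes> x) - f (a \<otimes> z)\<bar>" by linarith
  then obtain w where w: "w \<in> W" "e / 2 < \<bar>f (a \<otimes> x) - f (a \<otimes> w)\<bar>" using ayz by blast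
  have xc: "x \<in> carrier P" "w \<in> carrier P" using openin_carrier[OF W] xW w by auto
  define U' where "U' = U \<inter> {u \<in> topspace T. e / 2 < \<bar>f (u \<otimes> x) - f (u \<otimes> w)\<bar>}"
  have "openin T {u \<in> topspace T. e / 2 < \<bar>f (u \<otimes> x) - f (u \<otimes> w)\<bar>}"
    by (intro openin_real_greater continuous_intros right_continuous_real xc f)
  then have "openin T U'" using U by (simp add: U'_def openin_Int)
  moreover have "a \<in> U'" using ayz(1) w openin_subset[OF U(1)] by (auto simp: U'_def)
  ultimately show ?thesis
    using w by (intro exI[of _ w] exI[of _ U'] conjI) (auto simp: U'_def W_def abs_minus_commute)
qed

lemma separate_nearby_points:
  assumes f: "continuous_map T euclideanreal f" and e: "e > 0"
    and bad: "nowhere_small f e U0 W0"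
    and W0: "openin T W0"
    and U: "openin T U" "U \<noteq> {}" "U \<subseteq> U0"
    and S: "finite S" "S \<subseteq> topological_center P T" and d: "d > 0"
    and A: "finite A" "A \<subseteq> W0"
  shows "\<exists>B U'. finite B \<and> B \<subseteq> W0 \<and> openin T U' \<and> U' \<noteq> {} \<and> U' \<subseteq> U \<and>
    (\<forall>x\<in>A. \<exists>y\<in>B. (\<forall>s\<in>S. \<bar>f (s \<otimes> x) - f (s \<otimes> y)\<bar> < d) \<and>
       (\<forall>u\<in>U'. e / 2 \<le> \<bar>f (u \<otimes> x) - f (u \<otimes> y)\<bar>))"
  using A
proof (induction A)
  case empty
  show ?case using U by (intro exI[of _ "{}"] exI[of _ U]) auto
next
  case (insert x A)
  have xA: "x \<in> W0" "A \<subseteq> W0" using insert.prems by auto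
  from insert.IH[OF xA(2)] obtain B U' where B: "finite B" "B \<subseteq> W0" "openin T U'" "U' \<noteq> {}" "U' \<subseteq> U"
    "\<forall>x\<in>A. \<exists>y\<in>B. (\<forall>s\<in>S. \<bar>f (s \<otimes> x) - f (s \<otimes> y)\<bar> < d) \<and>
       (\<forall>u\<in>U'. e / 2 \<le> \<bar>f (u \<otimes> x) - f (u \<otimes> y)\<bar>)"
    by (elim exE conjE)
  have sub: "U' \<subseteq> U0" using B(5) U(3) by auto
  from separate_nearby_point[OF f e bad W0 B(3,4) sub S xA(1) d]
  obtain y U'' where y: "y \<in> W0" "openin T U''" "U'' \<noteq> {}" "U'' \<subseteq> U'"
    "\<forall>s\<in>S. \<bar>f (s \<otimes> x) - f (s \<otimes> y)\<bar> < d"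
    "\<forall>u\<in>U''. e / 2 \<le> \<bar>f (u \<otimes> x) - f (u \<otimes> y)\<bar>"
    by (elim exE conjE)
  show ?case
  proof (intro exI conjI)
    show "finite (insert y B)" "insert y B \<subseteq> W0" "openin T U''" "U'' \<noteq> {}" "U'' \<subseteq> U"
      using B(1,2,5) y(1-4) by auto
    show "\<forall>x\<in>insert x A. \<exists>y\<in>insert y B. (\<forall>s\<in>S. \<bar>f (s \<otimes> x) - f (s \<otimes> y)\<bar> < d) \<and>
       (\<forall>u\<in>U''. e / 2 \<le> \<bar>f (u \<otimes> x) - f (u \<otimes> y)\<bar>)"
    proof
      fix z assume "z \<in> insert x A"
      then consider "z = x" | "z \<in> A" by blast
      then show "\<exists>y\<in>insert y B. (\<forall>s\<in>S. \<bar>f (s \<otimes> z) - f (s \<otimes> y)\<bar> < d) \<and>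
         (\<forall>u\<in>U''. e / 2 \<le> \<bar>f (u \<otimes> z) - f (u \<otimes> y)\<bar>)"
      proof cases
        case 1
        then show ?thesis using y(5,6) by (intro bexI[of _ y]) auto
      next
        case 2
        then obtain w where w: "w \<in> B" "\<forall>s\<in>S. \<bar>f (s \<otimes> z) - f (s \<otimes> w)\<bar> < d"
          "\<forall>u\<in>U'. e / 2 \<le> \<bar>f (u \<otimes> z) - f (u \<otimes> w)\<bar>"
          using B(6) by blast
        then show ?thesis using y(4) by (intro bexI[of _ w]) auto
      qed
    qed
  qed
qed

text \<open>Iterated without end, the steps would give countable sets \<open>A\<close> and \<open>S\<close> and a cluster point
  \<open>a\<close> of \<open>S\<close> such that \<open>f (a \<otimes> _)\<close> factors through the functions \<open>f (s \<otimes> _)\<close>, \<open>s \<in> S\<close>, and yet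
  oscillates by \<open>e / 2\<close> near every point of \<open>A\<close> in the topology of these functions, contrary to
  fragmentability.\<close>

proposition small_oscillation_dense:
  assumes f: "continuous_map T euclideanreal f" and e: "e > 0"
    and U0: "openin T U0" "U0 \<noteq> {}" and W0: "openin T W0" "W0 \<noteq> {}"
  obtains U W where "openin T U" "U \<noteq> {}" "U \<subseteq> U0" "openin T W" "W \<noteq> {}" "W \<subseteq> W0"
    "small_oscillation f e U W"
proof (rule ccontr)
  assume "\<not> thesis"
  then have bad: "nowhere_small f e U0 W0"
    using that unfolding nowhere_small_def by blast
  let ?L = "topological_center P T"
  \<comment> \<open>A state consists of the points \<open>A\<close>, the centre elements \<open>S\<close>, and an open set \<open>U\<close> to which the
    cluster point is confined. Step \<open>n\<close> treats all points found so far, so each point of the limit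
    set is treated infinitely often, with ever more of \<open>S\<close> and ever smaller error.\<close>
  define state where "state p \<longleftrightarrow> (case p of (A, S, U) \<Rightarrow>
      finite A \<and> A \<subseteq> W0 \<and> A \<noteq> {} \<and> finite S \<and> S \<subseteq> ?L \<and> openin T U \<and> U \<noteq> {} \<and> U \<subseteq> U0)" for p
  define step where "step n p q \<longleftrightarrow> (case p of (A, S, U) \<Rightarrow> case q of (A', S', U') \<Rightarrow>
      A \<subseteq> A' \<and> S \<subseteq> S' \<and> U' \<subseteq> U \<and> S' \<inter> U' \<noteq> {} \<and>
      (\<forall>x\<in>A. \<exists>y\<in>A'. (\<forall>s\<in>S. \<bar>f (s \<otimes> x) - f (s \<otimes> y)\<bar> < 1 / Suc n) \<and>
         (\<forall>u\<in>U'. e / 2 \<le> \<bar>f (u \<otimes> x) - f (u \<otimes> y)\<bar>)))" for n :: nat and p q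
  have "\<exists>p. \<forall>n. state (p n) \<and> step n (p n) (p (Suc n))"
  proof (rule dependent_nat_choice)
    obtain x where "x \<in> W0" using W0 by auto
    then show "\<exists>p. state p"
      using U0 by (intro exI[of _ "({x}, {}, U0)"]) (simp add: state_def)
  next
    fix p n assume "state p"
    then obtain A S U where p: "p = (A, S, U)" "finite A" "A \<subseteq> W0" "A \<noteq> {}" "finite S" "S \<subseteq> ?L"
      "openin T U" "U \<noteq> {}" "U \<subseteq> U0"
      by (cases p) (auto simp: state_def)
    have "(0::real) < 1 / Suc n" by simp
    from separate_nearby_points[OF f e bad W0(1) p(7-9) p(5,6) this p(2,3)]
    obtain B U' where B: "finite B" "B \<subseteq> W0" "openin T U'" "U' \<noteq> {}" "U' \<subseteq> U"
      "\<forall>x\<in>A. \<exists>y\<in>B. (\<forall>s\<in>S. \<bar>f (s \<otimes> x) - f (s \<otimes> y)\<bar> < 1 / Suc n) \<and>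
         (\<forall>u\<in>U'. e / 2 \<le> \<bar>f (u \<otimes> x) - f (u \<otimes> y)\<bar>)"
      by (elim exE conjE)
    obtain s where s: "s \<in> ?L" "s \<in> U'" using center_meets_open[OF B(3,4)] .
    have "state (A \<union> B, insert s S, U')" using p B s by (auto simp: state_def)
    moreover have "step n p (A \<union> B, insert s S, U')"
      using B s unfolding p(1) step_def prod.case by (auto simp del: of_nat_Suc) blast
    ultimately show "\<exists>q. state q \<and> step n p q" by blast
  qed
  then obtain p where p: "\<And>n. state (p n)" "\<And>n. step n (p n) (p (Suc n))" by blast
  define A where "A n = fst (p n)" for n
  define S where "S n = fst (snd (p n))" for n
  define U where "U n = snd (snd (p n))" for n
  have p_eq: "p n = (A n, S n, U n)" for n by (simp add: A_def S_def U_def)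
  have st: "finite (A n)" "A n \<subseteq> W0" "A n \<noteq> {}" "finite (S n)" "S n \<subseteq> ?L" "openin T (U n)" for n
    using p(1)[of n] by (auto simp: state_def p_eq)
  have sp: "A n \<subseteq> A (Suc n)" "S n \<subseteq> S (Suc n)" "U (Suc n) \<subseteq> U n" "S (Suc n) \<inter> U (Suc n) \<noteq> {}"
    "\<And>x. x \<in> A n \<Longrightarrow> \<exists>y\<in>A (Suc n). (\<forall>s\<in>S n. \<bar>f (s \<otimes> x) - f (s \<otimes> y)\<bar> < 1 / Suc n) \<and>
         (\<forall>u\<in>U (Suc n). e / 2 \<le> \<bar>f (u \<otimes> x) - f (u \<otimes> y)\<bar>)" for n
    using p(2)[of n] unfolding step_def p_eq prod.case by simp_all
  have A_mono: "A m \<subseteq> A n" if "m \<le> n" for m n by (rule lift_Suc_mono_le[of A, OF sp(1) that])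
  have S_mono: "S m \<subseteq> S n" if "m \<le> n" for m n by (rule lift_Suc_mono_le[of S, OF sp(2) that])
  have U_anti: "U n \<subseteq> U m" if "m \<le> n" for m n by (rule lift_Suc_antimono_le[of U, OF sp(3) that])
  have "\<forall>n. \<exists>x. x \<in> S (Suc n) \<and> x \<in> U (Suc n)" using sp(4) by blast
  from choice[OF this] obtain s where s: "\<And>n. s n \<in> S (Suc n)" "\<And>n. s n \<in> U (Suc n)"
    by blast
  have s_carrier: "s n \<in> carrier P" for n using s(1) st(5) center_carrier by blast
  \<comment> \<open>Any cluster point \<open>a\<close> of the centre elements \<open>s n\<close> serves: closed conditions on \<open>u\<close> that
    eventually hold for the \<open>s n\<close> are inherited by \<open>a\<close>.\<close>
  have "(\<Inter>n. Abstract_Topology.closure_of T (s ` {n..})) \<noteq> {}"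
  proof (rule compact_space_imp_nest[OF compact])
    show "Abstract_Topology.closure_of T (s ` {n..}) \<noteq> {}" for n
      using s_carrier topspace_eq by (subst closure_of_eq_empty) auto
    show "decseq (\<lambda>n. Abstract_Topology.closure_of T (s ` {n..}))"
      by (intro decseq_SucI closure_of_mono image_mono) auto
  qed simp
  from this[unfolded ex_in_conv[symmetric]]
  obtain a where a: "\<And>n. a \<in> Abstract_Topology.closure_of T (s ` {n..})" by auto
  have a_carrier: "a \<in> carrier P" using a[of 0] topspace_eq by (simp add: in_closure_of)
  have limit: "a \<in> C" if "closedin T C" "\<And>m. n \<le> m \<Longrightarrow> s m \<in> C" for C n
  proof -
    have "Abstract_Topology.closure_of T (s ` {n..}) \<subseteq> C" using that by (intro closure_of_minimal) auto
    then show ?thesis using a by blast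
  qed
  let ?A = "\<Union>n. A n" and ?S = "\<Union>n. S n"
  have A_carrier: "?A \<subseteq> carrier P" using st(2) openin_carrier[OF W0(1)] by blast
  have diff_cont: "continuous_map T euclideanreal (\<lambda>u. \<bar>f (u \<otimes> x) - f (u \<otimes> y)\<bar>)"
    if "x \<in> carrier P" "y \<in> carrier P" for x y
    by (intro continuous_intros right_continuous_real that f)
  have factor: "f (a \<otimes> x) = f (a \<otimes> y)"
    if xy: "x \<in> carrier P" "y \<in> carrier P" and eq: "\<And>s. s \<in> ?S \<Longrightarrow> f (s \<otimes> x) = f (s \<otimes> y)" for x y
  proof -
    have "a \<in> {u \<in> topspace T. \<bar>f (u \<otimes> x) - f (u \<otimes> y)\<bar> \<le> 0}"
      using s(1) s_carrier topspace_eq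
      by (intro limit[of _ 0] closedin_real_le diff_cont xy) (auto intro!: eq)
    then show ?thesis by simp
  qed
  have "real_fragmented T (\<lambda>x. f (a \<otimes> x))" by (rule left_fragmented[OF a_carrier f])
  moreover have "\<forall>s\<in>?S. continuous_map T euclideanreal (\<lambda>x. f (s \<otimes> x))"
    using st(5) by (intro ballI left_continuous_real f) blast
  moreover have "?A \<subseteq> topspace T" using A_carrier by (simp only: topspace_eq)
  moreover have "?A \<noteq> {}" using st(3)[of 0] by blast
  moreover have "0 < e / 2" using e by simp
  moreover have "\<forall>x\<in>topspace T. \<forall>y\<in>topspace T.
      (\<forall>s\<in>?S. f (s \<otimes> x) = f (s \<otimes> y)) \<longrightarrow> f (a \<otimes> x) = f (a \<otimes> y)"
    by (intro ballI impI factor) (simp_all only: topspace_eq)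
  ultimately have "\<exists>x\<in>?A. \<exists>F d. finite F \<and> F \<subseteq> ?S \<and> d > 0 \<and>
      (\<forall>y\<in>?A. (\<forall>s\<in>F. \<bar>f (s \<otimes> x) - f (s \<otimes> y)\<bar> < d) \<longrightarrow> \<bar>f (a \<otimes> x) - f (a \<otimes> y)\<bar> < e / 2)"
    by (intro fragmented_factor_almost_continuous[OF compact])
  then obtain x F d where x: "x \<in> ?A" "finite F" "F \<subseteq> ?S" "d > 0"
    "\<forall>y\<in>?A. (\<forall>s\<in>F. \<bar>f (s \<otimes> x) - f (s \<otimes> y)\<bar> < d) \<longrightarrow> \<bar>f (a \<otimes> x) - f (a \<otimes> y)\<bar> < e / 2"
    by (elim bexE exE conjE)
  obtain n1 where n1: "x \<in> A n1" using x(1) by auto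
  have "\<exists>n. F \<subseteq> S n"
    using x(2,3)
  proof (induction F)
    case (insert s F)
    then obtain n m where "F \<subseteq> S n" "s \<in> S m" by auto
    then have "insert s F \<subseteq> S (max n m)"
      using S_mono[of n "max n m"] S_mono[of m "max n m"] by auto
    then show ?case by blast
  qed auto
  then obtain n2 where n2: "F \<subseteq> S n2" by blast
  obtain n3 where n3: "1 / real (Suc n3) < d" using x(4) nat_approx_posE by blast
  define n where "n = max n1 (max n2 n3)"
  have n_ge: "n1 \<le> n" "n2 \<le> n" "n3 \<le> n" by (simp_all add: n_def)
  have "x \<in> A n" "F \<subseteq> S n" using A_mono[OF n_ge(1)] n1 S_mono[OF n_ge(2)] n2 by auto
  moreover have "1 / real (Suc n) \<le> 1 / real (Suc n3)" using n_ge(3) by (intro divide_left_mono) auto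
  ultimately obtain y where y: "y \<in> A (Suc n)" "\<And>s. s \<in> F \<Longrightarrow> \<bar>f (s \<otimes> x) - f (s \<otimes> y)\<bar> < d"
    "\<And>u. u \<in> U (Suc n) \<Longrightarrow> e / 2 \<le> \<bar>f (u \<otimes> x) - f (u \<otimes> y)\<bar>"
    using sp(5)[of x n] n3 by (meson less_le_trans less_trans subsetD)
  have xy: "x \<in> carrier P" "y \<in> carrier P" using A_carrier x(1) y(1) by blast+
  have "a \<in> {u \<in> topspace T. e / 2 \<le> \<bar>f (u \<otimes> x) - f (u \<otimes> y)\<bar>}"
  proof (rule limit[of _ n])
    fix m assume "n \<le> m"
    then have "s m \<in> U (Suc n)" using s(2)[of m] U_anti[of "Suc n" "Suc m"] by auto
    then show "s m \<in> {u \<in> topspace T. e / 2 \<le> \<bar>f (u \<otimes> x) - f (u \<otimes> y)\<bar>}"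
      using y(3) s_carrier topspace_eq by auto
  qed (intro closedin_real_ge diff_cont xy)
  moreover have "\<bar>f (a \<otimes> x) - f (a \<otimes> y)\<bar> < e / 2" using x(5) y(1,2) by blast
  ultimately show False by auto
qed

lemma small_oscillation_dense_finite:
  assumes G: "finite G" "\<forall>f\<in>G. continuous_map T euclideanreal f" and e: "e > 0"
    and U0: "openin T U0" "U0 \<noteq> {}" and W0: "openin T W0" "W0 \<noteq> {}"
  shows "\<exists>U W. openin T U \<and> U \<noteq> {} \<and> U \<subseteq> U0 \<and> openin T W \<and> W \<noteq> {} \<and> W \<subseteq> W0 \<and>
    (\<forall>f\<in>G. small_oscillation f e U W)"
  using G
proof (induction G)
  case empty
  show ?case using U0 W0 by (intro exI[of _ U0] exI[of _ W0]) simp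
next
  case (insert f G)
  have "\<forall>f\<in>G. continuous_map T euclideanreal f" using insert.prems by simp
  from insert.IH[OF this] obtain U W where UW: "openin T U" "U \<noteq> {}" "U \<subseteq> U0"
    "openin T W" "W \<noteq> {}" "W \<subseteq> W0" "\<forall>f\<in>G. small_oscillation f e U W"
    by (elim exE conjE)
  have f: "continuous_map T euclideanreal f" using insert.prems by simp
  obtain U' W' where UW': "openin T U'" "U' \<noteq> {}" "U' \<subseteq> U" "openin T W'" "W' \<noteq> {}" "W' \<subseteq> W"
    "small_oscillation f e U' W'"
    by (rule small_oscillation_dense[OF f e UW(1,2,4,5)])
  have "\<forall>g\<in>insert f G. small_oscillation g e U' W'"
    using UW(7) UW'(3,6,7) small_oscillation_mono by blast
  then show ?case using UW(3,6) UW'(1-6) by (meson order_trans)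
qed

section \<open>Small oscillation at the identity\<close>

text \<open>Choose finitely many right translates of a bump function \<open>h\<close> supported in \<open>V\<close> such that
  everywhere one of them exceeds \<open>1 / 2\<close>, and a product that is small for all of them, as well as
  for the same translates of \<open>f\<close>. Some translate then stays positive on the whole product after
  \<open>U\<close> is shrunk, and absorbing its translation into \<open>W\<close> puts all products into \<open>V\<close>.\<close>

lemma small_oscillation_into_open:
  assumes f: "continuous_map T euclideanreal f" and e: "e > 0" and V: "openin T V" "V \<noteq> {}"
  obtains U W where "openin T U" "U \<noteq> {}" "openin T W" "W \<noteq> {}" "small_oscillation f e U W"
    "\<forall>a\<in>U. \<forall>x\<in>W. a \<otimes> x \<in> V"
proof -
  obtain v where v: "v \<in> V" using V by auto
  obtain h where h: "continuous_map T euclideanreal h" "h v = 1"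
    "\<forall>y\<in>carrier P - V. h y = 0"
    using separating_function[OF V(1) v] .
  have vc: "v \<in> carrier P" using openin_carrier[OF V(1) v] .
  define \<gamma> where "\<gamma> x = inv x \<otimes> v" for x
  have \<gamma>: "\<gamma> x \<in> carrier P" if "x \<in> carrier P" for x using that vc by (simp add: \<gamma>_def)
  define N where "N x = {z \<in> topspace T. 1 / 2 < h (z \<otimes> \<gamma> x)}" for x
  have "openin T (N x) \<and> x \<in> N x" if "x \<in> topspace T" for x
  proof
    show "openin T (N x)"
      unfolding N_def using that topspace_eq \<gamma> by (intro openin_real_greater right_continuous_real h) auto
    have "x \<otimes> \<gamma> x = v" using that topspace_eq vc by (simp add: \<gamma>_def m_assoc[symmetric])
    then show "x \<in> N x" using that h(2) by (simp add: N_def)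
  qed
  then obtain F where F: "finite F" "F \<subseteq> topspace T" "topspace T \<subseteq> (\<Union>x\<in>F. N x)"
    by (rule compact_space_finite_subcover[OF compact])
  have Fc: "\<gamma> x \<in> carrier P" if "x \<in> F" for x using that F(2) topspace_eq \<gamma> by blast
  define G where "G = (\<lambda>x z. h (z \<otimes> \<gamma> x)) ` F \<union> (\<lambda>x z. f (z \<otimes> \<gamma> x)) ` F"
  have G: "finite G" using F(1) by (simp add: G_def)
  have Gc: "\<forall>g\<in>G. continuous_map T euclideanreal g"
    using Fc h(1) f by (auto simp: G_def intro!: right_continuous_real)
  have "carrier P \<noteq> {}" by blast
  then have ne: "topspace T \<noteq> {}" using topspace_eq by simp
  have e': "min e (1 / 4) > 0" using e by simp
  from small_oscillation_dense_finite[OF G Gc e' openin_topspace ne openin_topspace ne]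
  obtain U0 W0 where UW0: "openin T U0" "U0 \<noteq> {}" "openin T W0" "W0 \<noteq> {}"
    "\<forall>g\<in>G. small_oscillation g (min e (1 / 4)) U0 W0"
    by (elim exE conjE)
  obtain a x where ax: "a \<in> U0" "x \<in> W0" using UW0 by blast
  have Uc: "U0 \<subseteq> carrier P" "W0 \<subseteq> carrier P" using openin_carrier UW0 by blast+
  then have axc: "a \<in> carrier P" "x \<in> carrier P" "a \<otimes> x \<in> topspace T" using ax topspace_eq by auto
  then obtain y where y: "y \<in> F" "1 / 2 < h (a \<otimes> x \<otimes> \<gamma> y)" using F(3) by (auto simp: N_def)
  define g where "g = \<gamma> y"
  have gc: "g \<in> carrier P" using Fc[OF y(1)] by (simp add: g_def)
  have hg: "small_oscillation (\<lambda>z. h (z \<otimes> g)) (min e (1 / 4)) U0 W0"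
    and fg: "small_oscillation (\<lambda>z. f (z \<otimes> g)) (min e (1 / 4)) U0 W0"
    using UW0(5) y(1) by (auto simp: G_def g_def)
  define U where "U = U0 \<inter> {b \<in> topspace T. 1 / 2 < h (b \<otimes> (x \<otimes> g))}"
  define W where "W = (\<lambda>z. z \<otimes> g) ` W0"
  have xg: "x \<otimes> g \<in> carrier P" using axc(2) gc by simp
  show thesis
  proof
    show "openin T U"
      unfolding U_def by (intro openin_Int UW0(1) openin_real_greater right_continuous_real xg h(1))
    have "a \<in> U" using ax y(2) axc gc topspace_eq by (simp add: U_def g_def[symmetric] m_assoc)
    then show "U \<noteq> {}" by blast
    show "openin T W" unfolding W_def by (rule right_translate_open[OF UW0(3) gc])
    show "W \<noteq> {}" using UW0(4) by (simp add: W_def)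
    show "small_oscillation f e U W"
      unfolding small_oscillation_def
    proof (intro ballI)
      fix b p q assume b: "b \<in> U" and "p \<in> W" "q \<in> W"
      then obtain p' q' where p: "p' \<in> W0" "p = p' \<otimes> g" and q: "q' \<in> W0" "q = q' \<otimes> g"
        by (auto simp: W_def)
      have c: "b \<in> carrier P" "p' \<in> carrier P" "q' \<in> carrier P" using b p q Uc by (auto simp: U_def)
      have "\<bar>f (b \<otimes> p' \<otimes> g) - f (b \<otimes> q' \<otimes> g)\<bar> \<le> min e (1 / 4)"
        using fg b p(1) q(1) by (simp add: small_oscillation_def U_def)
      then show "\<bar>f (b \<otimes> p) - f (b \<otimes> q)\<bar> \<le> e" using c gc p(2) q(2) by (simp add: m_assoc)
    qed
    show "\<forall>a\<in>U. \<forall>x\<in>W. a \<otimes> x \<in> V"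
    proof (intro ballI)
      fix b p assume b: "b \<in> U" and "p \<in> W"
      then obtain p' where p: "p' \<in> W0" "p = p' \<otimes> g" by (auto simp: W_def)
      have c: "b \<in> carrier P" "p' \<in> carrier P" using b p Uc by (auto simp: U_def)
      have "\<bar>h (b \<otimes> p' \<otimes> g) - h (b \<otimes> x \<otimes> g)\<bar> \<le> min e (1 / 4)"
        using hg b p(1) ax(2) by (simp add: small_oscillation_def U_def)
      moreover have "1 / 2 < h (b \<otimes> x \<otimes> g)" using b c axc gc by (simp add: U_def m_assoc)
      ultimately have "h (b \<otimes> p) \<noteq> 0" using c gc p(2) by (auto simp: m_assoc)
      then show "b \<otimes> p \<in> V" using h(3)[rule_format, of "b \<otimes> p"] c gc p(2) by auto
    qed
  qed
qed

text \<open>Take \<open>U \<times> W\<close> small with products in \<open>V\<close>, and \<open>t \<in> W\<close> in the centre. As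
  \<open>(u \<otimes> t) \<otimes> x = u \<otimes> (t \<otimes> x)\<close>, the translates \<open>U \<otimes> t\<close> and \<open>inv t \<otimes> W\<close> form a small product
  again, now around \<open>\<one>\<close> in the second factor. Membership of \<open>t\<close> in the centre makes
  \<open>inv t \<otimes> W\<close> open.\<close>

lemma small_oscillation_at_one_dense:
  assumes f: "continuous_map T euclideanreal f" and e: "e > 0" and V: "openin T V" "V \<noteq> {}"
  obtains U N where "openin T U" "U \<noteq> {}" "U \<subseteq> V" "openin T N" "\<one> \<in> N" "small_oscillation f e U N"
proof -
  obtain U W where UW: "openin T U" "U \<noteq> {}" "openin T W" "W \<noteq> {}" "small_oscillation f e U W"
    "\<forall>a\<in>U. \<forall>x\<in>W. a \<otimes> x \<in> V"
    by (rule small_oscillation_into_open[OF f e V])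
  obtain t where t: "t \<in> topological_center P T" "t \<in> W" using center_meets_open[OF UW(3,4)] .
  have tc: "t \<in> carrier P" using center_carrier[OF t(1)] .
  show thesis
  proof
    show "openin T ((\<lambda>x. x \<otimes> t) ` U)" by (rule right_translate_open[OF UW(1) tc])
    show "(\<lambda>x. x \<otimes> t) ` U \<noteq> {}" using UW(2) by simp
    show "(\<lambda>x. x \<otimes> t) ` U \<subseteq> V" using UW(6) t(2) by blast
    show "openin T {x \<in> carrier P. t \<otimes> x \<in> W}" by (rule openin_left_preimage[OF UW(3) t(1)])
    show "\<one> \<in> {x \<in> carrier P. t \<otimes> x \<in> W}" using t(2) tc by simp
    show "small_oscillation f e ((\<lambda>x. x \<otimes> t) ` U) {x \<in> carrier P. t \<otimes> x \<in> W}"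
      unfolding small_oscillation_def
    proof (intro ballI)
      fix b x y assume b: "b \<in> (\<lambda>x. x \<otimes> t) ` U" and x: "x \<in> {x \<in> carrier P. t \<otimes> x \<in> W}"
        and y: "y \<in> {x \<in> carrier P. t \<otimes> x \<in> W}"
      obtain u where u: "u \<in> U" "b = u \<otimes> t" using b by blast
      have "u \<in> carrier P" using openin_carrier[OF UW(1) u(1)] .
      moreover have "\<bar>f (u \<otimes> (t \<otimes> x)) - f (u \<otimes> (t \<otimes> y))\<bar> \<le> e"
        using UW(5) u(1) x y by (simp add: small_oscillation_def)
      ultimately show "\<bar>f (b \<otimes> x) - f (b \<otimes> y)\<bar> \<le> e" using u(2) x y tc by (simp add: m_assoc)
    qed
  qed
qed

text \<open>If \<open>f\<close> separates the two coordinates of \<open>p\<close> by \<open>e\<close>, then \<open>M\<close> is a neighbourhood that the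
  pairs \<open>(b \<otimes> u, b \<otimes> w)\<close> avoid altogether: some \<open>r\<close> in the centre maps \<open>M\<close> to pairs that \<open>f\<close>
  separates by more than \<open>e / 2\<close>, while \<open>r \<otimes> a\<close> lies in an open set on which the oscillation near
  \<open>\<one>\<close> is at most \<open>e / 2\<close>.\<close>

lemma small_oscillation_near_pair:
  assumes f: "continuous_map T euclideanreal f" and e: "e > 0" and a: "a \<in> carrier P"
    and p: "p \<in> topspace (prod_topology T T)"
  shows "\<exists>M U N. openin (prod_topology T T) M \<and> p \<in> M \<and> openin T U \<and> a \<in> U \<and> openin T N \<and> \<one> \<in> N \<and>
    (\<forall>b\<in>U. \<forall>u\<in>N. \<forall>w\<in>N. (b \<otimes> u, b \<otimes> w) \<in> M \<longrightarrow> \<bar>f (b \<otimes> u) - f (b \<otimes> w)\<bar> \<le> e)"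
proof -
  have pair_cont: "continuous_map (prod_topology T T) euclideanreal (\<lambda>q. \<bar>g (fst q) - g (snd q)\<bar>)"
    if "continuous_map T euclideanreal g" for g
    by (intro continuous_intros continuous_map_compose[OF _ that, unfolded o_def]
        continuous_map_fst continuous_map_snd)
  obtain x y where xy: "p = (x, y)" "x \<in> carrier P" "y \<in> carrier P"
    using p topspace_eq by (cases p) auto
  show ?thesis
  proof (cases "\<bar>f x - f y\<bar> < e")
    case True
    define M where "M = {q \<in> topspace (prod_topology T T). \<bar>f (fst q) - f (snd q)\<bar> < e}"
    have "openin (prod_topology T T) M"
      unfolding M_def by (intro openin_real_less pair_cont f)
    moreover have "p \<in> M" using True p xy(1) by (simp add: M_def)
    moreover have "\<forall>q\<in>M. \<bar>f (fst q) - f (snd q)\<bar> \<le> e" by (simp add: M_def)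
    ultimately show ?thesis
      using a openin_topspace[of T, unfolded topspace_eq]
      by (intro exI[of _ M] exI[of _ "carrier P"] conjI) auto
  next
    case False
    define R where "R = {r \<in> topspace T. e / 2 < \<bar>f (r \<otimes> x) - f (r \<otimes> y)\<bar>}"
    have R: "openin T R"
      unfolding R_def by (intro openin_real_greater continuous_intros right_continuous_real xy f)
    have "\<one> \<in> R" using False e xy topspace_eq by (simp add: R_def)
    then have "(\<lambda>r. r \<otimes> a) ` R \<noteq> {}" by blast
    then obtain V N where VN: "openin T V" "V \<noteq> {}" "V \<subseteq> (\<lambda>r. r \<otimes> a) ` R" "openin T N" "\<one> \<in> N"
      "small_oscillation f (e / 2) V N"
      using small_oscillation_at_one_dense[OF f _ right_translate_open[OF R a], of "e / 2"] e by auto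
    have "openin T (R \<inter> {r \<in> carrier P. r \<otimes> a \<in> V})"
      by (intro openin_Int R openin_right_preimage VN(1) a)
    moreover have "R \<inter> {r \<in> carrier P. r \<otimes> a \<in> V} \<noteq> {}"
      using VN(2,3) openin_carrier[OF R] by blast
    ultimately obtain r where r: "r \<in> topological_center P T" "r \<in> R" "r \<otimes> a \<in> V"
      using center_meets_open by blast
    have rc: "r \<in> carrier P" using center_carrier[OF r(1)] .
    define M where "M = {q \<in> topspace (prod_topology T T). e / 2 < \<bar>f (r \<otimes> fst q) - f (r \<otimes> snd q)\<bar>}"
    define U where "U = {b \<in> carrier P. r \<otimes> b \<in> V}"
    have "openin (prod_topology T T) M"
      unfolding M_def by (intro openin_real_greater pair_cont left_continuous_real r(1) f)
    moreover have "p \<in> M" using r(2) p xy(1) by (simp add: M_def R_def)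
    moreover have "openin T U" unfolding U_def by (rule openin_left_preimage[OF VN(1) r(1)])
    moreover have "a \<in> U" using a r(3) by (simp add: U_def)
    moreover have "(b \<otimes> u, b \<otimes> w) \<notin> M" if "b \<in> U" "u \<in> N" "w \<in> N" for b u w
    proof -
      have "\<bar>f (r \<otimes> b \<otimes> u) - f (r \<otimes> b \<otimes> w)\<bar> \<le> e / 2"
        using VN(6) that by (simp add: small_oscillation_def U_def)
      moreover have "b \<in> carrier P" "u \<in> carrier P" "w \<in> carrier P"
        using that openin_carrier[OF VN(4)] by (auto simp: U_def)
      ultimately show ?thesis using rc by (simp add: M_def m_assoc)
    qed
    ultimately show ?thesis using VN(4,5)
      by (intro exI[of _ M] exI[of _ U] exI[of _ N] conjI) auto
  qed
qed

proposition small_oscillation_at_one: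
  assumes f: "continuous_map T euclideanreal f" and e: "e > 0" and a: "a \<in> carrier P"
  obtains U N where "openin T U" "a \<in> U" "openin T N" "\<one> \<in> N" "small_oscillation f e U N"
proof -
  define good where "good p M U N \<longleftrightarrow> openin (prod_topology T T) M \<and> p \<in> M \<and>
      openin T U \<and> a \<in> U \<and> openin T N \<and> \<one> \<in> N \<and>
      (\<forall>b\<in>U. \<forall>u\<in>N. \<forall>w\<in>N. (b \<otimes> u, b \<otimes> w) \<in> M \<longrightarrow> \<bar>f (b \<otimes> u) - f (b \<otimes> w)\<bar> \<le> e)"
    for p M U N
  have "\<forall>p\<in>topspace (prod_topology T T). \<exists>M U N. good p M U N"
    unfolding good_def by (rule ballI) (rule small_oscillation_near_pair[OF f e a])
  then obtain M U N where good: "\<forall>p\<in>topspace (prod_topology T T). good p (M p) (U p) (N p)"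
    by metis
  have "compact_space (prod_topology T T)" using compact by (simp add: compact_space_prod_topology)
  moreover have "openin (prod_topology T T) (M p) \<and> p \<in> M p" if "p \<in> topspace (prod_topology T T)" for p
    using good[rule_format, OF that] by (simp add: good_def)
  ultimately obtain F where F: "finite F" "F \<subseteq> topspace (prod_topology T T)"
    "topspace (prod_topology T T) \<subseteq> (\<Union>p\<in>F. M p)"
    by (rule compact_space_finite_subcover)
  define U' where "U' = \<Inter>(insert (topspace T) (U ` F))"
  define N' where "N' = \<Inter>(insert (topspace T) (N ` F))"
  have Fp: "openin T (U p)" "a \<in> U p" "openin T (N p)" "\<one> \<in> N p"
    "\<forall>b\<in>U p. \<forall>u\<in>N p. \<forall>w\<in>N p. (b \<otimes> u, b \<otimes> w) \<in> M p \<longrightarrow> \<bar>f (b \<otimes> u) - f (b \<otimes> w)\<bar> \<le> e"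
    if "p \<in> F" for p
    using good[rule_format, OF subsetD[OF F(2) that]] by (simp_all add: good_def)
  show thesis
  proof
    show "openin T U'" unfolding U'_def using F(1) Fp(1) by (intro openin_Inter) auto
    show "a \<in> U'" unfolding U'_def using Fp(2) a topspace_eq by simp
    show "openin T N'" unfolding N'_def using F(1) Fp(3) by (intro openin_Inter) auto
    show "\<one> \<in> N'" unfolding N'_def using Fp(4) topspace_eq by simp
    show "small_oscillation f e U' N'"
      unfolding small_oscillation_def
    proof (intro ballI)
      fix b u w assume b: "b \<in> U'" and u: "u \<in> N'" and w: "w \<in> N'"
      have "b \<in> carrier P" "u \<in> carrier P" "w \<in> carrier P"
        using b u w by (simp_all add: U'_def N'_def topspace_eq)
      then have "(b \<otimes> u, b \<otimes> w) \<in> topspace (prod_topology T T)" by (simp add: topspace_eq)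
      then obtain p where p: "p \<in> F" "(b \<otimes> u, b \<otimes> w) \<in> M p" using F(3) by blast
      have "b \<in> U p" "u \<in> N p" "w \<in> N p" using b u w p(1) by (simp_all add: U'_def N'_def)
      then show "\<bar>f (b \<otimes> u) - f (b \<otimes> w)\<bar> \<le> e" using Fp(5)[OF p(1)] p(2) by simp
    qed
  qed
qed

section \<open>Joint continuity\<close>

text \<open>Replacing a bump function \<open>h\<close> at \<open>a \<otimes> x\<close> by \<open>h (_ \<otimes> x)\<close> reduces continuity at \<open>(a, x)\<close> to the
  oscillation bound near \<open>(a, \<one>)\<close>.\<close>

lemma mult_continuous: "continuous_map (prod_topology T T) T (\<lambda>(x, y). x \<otimes> y)"
  unfolding continuous_map_def
proof (intro conjI allI impI funcsetI)
  show "(case p of (x, y) \<Rightarrow> x \<otimes> y) \<in> topspace T" if "p \<in> topspace (prod_topology T T)" for p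
    using that by (auto simp: topspace_eq)
  fix V assume V: "openin T V"
  show "openin (prod_topology T T) {p \<in> topspace (prod_topology T T). (case p of (x, y) \<Rightarrow> x \<otimes> y) \<in> V}"
    unfolding openin_prod_topology_alt
  proof (intro allI impI)
    fix a x assume "(a, x) \<in> {p \<in> topspace (prod_topology T T). (case p of (x, y) \<Rightarrow> x \<otimes> y) \<in> V}"
    then have ax: "a \<in> carrier P" "x \<in> carrier P" "a \<otimes> x \<in> V" by (auto simp: topspace_eq)
    obtain h where h: "continuous_map T euclideanreal h" "h (a \<otimes> x) = 1"
      "\<forall>y\<in>carrier P - V. h y = 0"
      using separating_function[OF V ax(3)] .
    have hx: "continuous_map T euclideanreal (\<lambda>z. h (z \<otimes> x))" by (rule right_continuous_real[OF ax(2) h(1)])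
    obtain U N where UN: "openin T U" "a \<in> U" "openin T N" "\<one> \<in> N"
      "small_oscillation (\<lambda>z. h (z \<otimes> x)) (1 / 4) U N"
      by (rule small_oscillation_at_one[OF hx _ ax(1), of "1 / 4"]) simp_all
    define U' where "U' = U \<inter> {b \<in> topspace T. 1 / 2 < h (b \<otimes> x)}"
    define N' where "N' = (\<lambda>z. z \<otimes> x) ` N"
    have "openin T U'" unfolding U'_def by (intro openin_Int UN(1) openin_real_greater hx)
    moreover have "openin T N'" unfolding N'_def by (rule right_translate_open[OF UN(3) ax(2)])
    moreover have "a \<in> U'" using UN(2) ax(1) h(2) by (simp add: U'_def topspace_eq)
    moreover have "x \<in> N'" unfolding N'_def using UN(4) ax(2) by (intro image_eqI[of _ _ \<one>]) simp_all
    moreover have "U' \<times> N' \<subseteq> {p \<in> topspace (prod_topology T T). (case p of (x, y) \<Rightarrow> x \<otimes> y) \<in> V}"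
    proof clarify
      fix b y assume b: "b \<in> U'" and "y \<in> N'"
      then obtain u where u: "u \<in> N" "y = u \<otimes> x" by (auto simp: N'_def)
      have c: "b \<in> carrier P" "u \<in> carrier P"
        using b openin_carrier[OF UN(3) u(1)] by (simp_all add: U'_def topspace_eq)
      have "\<bar>h (b \<otimes> u \<otimes> x) - h (b \<otimes> \<one> \<otimes> x)\<bar> \<le> 1 / 4"
        using UN(4,5) b u(1) by (simp add: small_oscillation_def U'_def)
      moreover have "1 / 2 < h (b \<otimes> \<one> \<otimes> x)" using b c by (simp add: U'_def)
      ultimately have "h (b \<otimes> y) \<noteq> 0" using c ax(2) u(2) by (auto simp: m_assoc)
      then have "b \<otimes> y \<in> V" using h(3)[rule_format, of "b \<otimes> y"] c ax(2) u(2) by auto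
      then show "(b, y) \<in> topspace (prod_topology T T) \<and> b \<otimes> y \<in> V"
        using c ax(2) u(2) by (simp add: topspace_eq)
    qed
    ultimately show "\<exists>U W. openin T U \<and> openin T W \<and> a \<in> U \<and> x \<in> W \<and>
        U \<times> W \<subseteq> {p \<in> topspace (prod_topology T T). (case p of (x, y) \<Rightarrow> x \<otimes> y) \<in> V}"
      by blast
  qed
qed

text \<open>The preimage of a closed \<open>C\<close> is the projection of the closed set of all pairs in \<open>P \<times> C\<close>
  with product \<open>\<one>\<close>, and projection along a compact factor is a closed map.\<close>

lemma inv_continuous: "continuous_map T T (\<lambda>x. inv x)"
  unfolding continuous_map_closedin
proof (intro conjI allI impI funcsetI)
  show "inv x \<in> topspace T" if "x \<in> topspace T" for x using that by (simp add: topspace_eq)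
  fix C assume C: "closedin T C"
  define G where "G = {p \<in> topspace (prod_topology T T). (case p of (x, y) \<Rightarrow> x \<otimes> y) \<in> {\<one>}}
    \<inter> topspace T \<times> C"
  have "closedin T {\<one>}" using Hausdorff topspace_eq by (simp add: closedin_Hausdorff_singleton)
  then have "closedin (prod_topology T T) G"
    unfolding G_def
    by (intro closedin_Int closedin_continuous_map_preimage[OF mult_continuous])
      (use C in \<open>simp_all add: closedin_prod_Times_iff\<close>)
  then have "closedin T (fst ` G)"
    using Abstract_Topological_Spaces.closed_map_fst[OF compact] by (auto simp: closed_map_def)
  moreover have "fst ` G = {x \<in> topspace T. inv x \<in> C}"
  proof (intro equalityI subsetI)
    fix x assume "x \<in> fst ` G"
    then obtain y where y: "(x, y) \<in> G" by auto
    then have c: "x \<in> carrier P" "y \<in> carrier P" "x \<otimes> y = \<one>" "y \<in> C" by (auto simp: G_def topspace_eq)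
    then have "inv x = y" by (metis inv_equality inv_comm)
    then show "x \<in> {x \<in> topspace T. inv x \<in> C}" using c by (simp add: topspace_eq)
  next
    fix x assume "x \<in> {x \<in> topspace T. inv x \<in> C}"
    then have "(x, inv x) \<in> G" by (auto simp: G_def topspace_eq)
    then show "x \<in> fst ` G" by force
  qed
  ultimately show "closedin T {x \<in> topspace T. inv x \<in> C}" by simp
qed

end

theorem theorem8p6:
  fixes P :: "('a, 'b) monoid_scheme" and T :: "'a topology"
  assumes "right_topological_group P T" and "compact_space T"
    and "tame P T"
  shows "topological_group P T"
proof -
  have grp: "group P" and sg: "right_topological_semigroup P T"
    using assms(1) by (auto simp: right_topological_group_def)
  have top: "topspace T = carrier P" "Hausdorff_space T" "\<And>a. a \<in> carrier P \<Longrightarrow> continuous_map T T (\<lambda>x. x \<otimes>\<^bsub>P\<^esub> a)"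
    using sg by (auto simp: right_topological_semigroup_def)
  have dense: "Abstract_Topology.closure_of T (topological_center P T) = topspace T"
    using assms(3) by (simp add: tame_def admissible_def)
  have frag: "real_fragmented T (\<lambda>x. f (a \<otimes>\<^bsub>P\<^esub> x))"
    if "a \<in> carrier P" "continuous_map T euclideanreal f" for a f
    using real_fragmented_comp[OF assms(2) top(2) _ that(2), of "\<lambda>x. a \<otimes>\<^bsub>P\<^esub> x"] assms(3) that(1)
    by (simp add: tame_def o_def)
  interpret fragmented_group P T
    using grp top assms(2) dense frag by (simp add: fragmented_group_def fragmented_group_axioms_def)
  show ?thesis
    using grp top mult_continuous inv_continuous by (simp add: topological_group_def)
qed

end
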